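(* Let $T$ be a singular weighted tree with $n$ vertices. The following are equivalent: (i) The number of alternating paths in $T$ is $n-1$. (ii) $T^{\#}$ is a tree. (iii) $T$ is a star. (iv) $T^{\#}$ is isomorphic to $T$.
   Context: A weighted tree has a nonzero real weight on each edge; it is singular if its adjacency matrix $A$ ($(i,j)$ entry equal to the weight of edge $v_iv_j$, or $0$ if no edge) is singular. $A^{\#}$ is the group inverse of $A$ (unique $X$ with $AXA=A$, $XAX=X$, $AX=XA$); $T^{\#}$ is the weighted graph on the vertex set of $T$ with $v_iv_j$ an edge iff $(A^{\#})_{ij}\neq 0$, weighted by that entry. Given a maximum matching $M$ of $T$, a path is alternating with respect to $M$ if its edges are alternately in $M$ and not in $M$, with first and last edges in $M$; the alternating paths of $T$ are the paths of $T$ that are alternating with respect to some maximum matching of $T$ (counted as paths, i.e. by their unordered pair of endpoints). Weighted graphs are isomorphic if their underlying unweighted graphs are isomorphic. *)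

theory Defs
  imports "Jordan_Normal_Form.Determinant"
begin

text \<open>Graphs on the vertex set {0..<n} are given by an adjacency predicate.
  The (weighted) graph of a square matrix: v_i v_j is an edge iff the (i,j) entry is nonzero.\<close>

definition mat_graph :: "real mat \<Rightarrow> nat \<Rightarrow> nat \<Rightarrow> bool" where
  "mat_graph A i j \<longleftrightarrow> i < dim_row A \<and> j < dim_col A \<and> A $$ (i, j) \<noteq> 0"

definition graph_path :: "nat \<Rightarrow> (nat \<Rightarrow> nat \<Rightarrow> bool) \<Rightarrow> nat list \<Rightarrow> bool" where
  "graph_path n adj vs \<longleftrightarrow> 2 \<le> length vs \<and> distinct vs \<and> set vs \<subseteq> {..<n} \<and>
     (\<forall>i < length vs - 1. adj (vs ! i) (vs ! Suc i))"

definition simple_graph :: "nat \<Rightarrow> (nat \<Rightarrow> nat \<Rightarrow> bool) \<Rightarrow> bool" where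
  "simple_graph n adj \<longleftrightarrow> (\<forall>i j. adj i j \<longrightarrow> i < n \<and> j < n \<and> adj j i) \<and> (\<forall>i. \<not> adj i i)"

definition graph_connected :: "nat \<Rightarrow> (nat \<Rightarrow> nat \<Rightarrow> bool) \<Rightarrow> bool" where
  "graph_connected n adj \<longleftrightarrow> (\<forall>i < n. \<forall>j < n. adj\<^sup>*\<^sup>* i j)"

definition graph_acyclic :: "nat \<Rightarrow> (nat \<Rightarrow> nat \<Rightarrow> bool) \<Rightarrow> bool" where
  "graph_acyclic n adj \<longleftrightarrow>
     \<not> (\<exists>vs. 3 \<le> length vs \<and> graph_path n adj vs \<and> adj (last vs) (hd vs))"

definition is_tree :: "nat \<Rightarrow> (nat \<Rightarrow> nat \<Rightarrow> bool) \<Rightarrow> bool" where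
  "is_tree n adj \<longleftrightarrow> 1 \<le> n \<and> simple_graph n adj \<and> graph_connected n adj \<and> graph_acyclic n adj"

definition is_star :: "nat \<Rightarrow> (nat \<Rightarrow> nat \<Rightarrow> bool) \<Rightarrow> bool" where
  "is_star n adj \<longleftrightarrow> (\<exists>c < n. \<forall>i j. adj i j \<longleftrightarrow> i < n \<and> j < n \<and> i \<noteq> j \<and> (i = c \<or> j = c))"

definition graph_iso :: "nat \<Rightarrow> (nat \<Rightarrow> nat \<Rightarrow> bool) \<Rightarrow> (nat \<Rightarrow> nat \<Rightarrow> bool) \<Rightarrow> bool" where
  "graph_iso n adj1 adj2 \<longleftrightarrow>
     (\<exists>f. bij_betw f {..<n} {..<n} \<and> (\<forall>i < n. \<forall>j < n. adj1 i j \<longleftrightarrow> adj2 (f i) (f j)))"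

definition group_inverse :: "real mat \<Rightarrow> real mat" where
  "group_inverse A = (THE X. X \<in> carrier_mat (dim_row A) (dim_row A) \<and>
      A * X * A = A \<and> X * A * X = X \<and> A * X = X * A)"

definition graph_edges :: "(nat \<Rightarrow> nat \<Rightarrow> bool) \<Rightarrow> nat set set" where
  "graph_edges adj = {{i, j} | i j. adj i j}"

definition is_matching :: "(nat \<Rightarrow> nat \<Rightarrow> bool) \<Rightarrow> nat set set \<Rightarrow> bool" where
  "is_matching adj M \<longleftrightarrow> M \<subseteq> graph_edges adj \<and> (\<forall>e\<in>M. \<forall>f\<in>M. e \<noteq> f \<longrightarrow> e \<inter> f = {})"

definition is_max_matching :: "(nat \<Rightarrow> nat \<Rightarrow> bool) \<Rightarrow> nat set set \<Rightarrow> bool" where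
  "is_max_matching adj M \<longleftrightarrow> is_matching adj M \<and> (\<forall>M'. is_matching adj M' \<longrightarrow> card M' \<le> card M)"

text \<open>Alternating path w.r.t. M: edges alternately in / not in M, first and last in M.\<close>
definition alternating_path :: "nat \<Rightarrow> (nat \<Rightarrow> nat \<Rightarrow> bool) \<Rightarrow> nat set set \<Rightarrow> nat list \<Rightarrow> bool" where
  "alternating_path n adj M vs \<longleftrightarrow> graph_path n adj vs \<and> even (length vs) \<and>
     (\<forall>i < length vs - 1. ({vs ! i, vs ! Suc i} \<in> M \<longleftrightarrow> even i))"

text \<open>Alternating paths of the graph, counted by unordered pairs of endpoints.\<close>
definition alternating_paths :: "nat \<Rightarrow> (nat \<Rightarrow> nat \<Rightarrow> bool) \<Rightarrow> nat set set" where
  "alternating_paths n adj = {{hd vs, last vs} | vs. \<exists>M. is_max_matching adj M \<and> alternating_path n adj M vs}"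

end

theory Submission
  imports Defs
begin

text \<open>
  If (i) holds: an edge lying in some maximum matching is an alternating path, and any other edge
  is the middle edge of an alternating path with three edges whose ends are the mates of its
  endpoints under one fixed maximum matching. This injects the edges into the alternating paths.
  A singular tree has no perfect matching, since a nonzero kernel vector together with a perfect
  matching would generate an infinite walk that never turns back. Local exchanges at a vertex
  missed by a maximum matching then give an alternating path outside the image of the injection,
  unless the tree is a star.

  If (ii) holds, \<open>A\<close> and \<open>B = A\<^sup>#\<close> are both trees, and their roles are symmetric. Let \<open>D\<close> be the
  set of vertices at which some kernel vector does not vanish. Walks that never turn back show
  that a neighbour of \<open>D\<close> in \<open>A\<close> has all its neighbours in \<open>B\<close> inside \<open>D\<close>, and by symmetry also all its
  neighbours in \<open>A\<close>. Choose a neighbour \<open>k\<close> of \<open>D\<close> with at most one neighbour \<open>d\<close> that is not a leaf of \<open>A\<close>.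
  As \<open>B\<close> has no 4-cycle, \<open>d\<close> and the leaves at \<open>k\<close> are all leaves of \<open>B\<close> at \<open>k\<close>; hence their rows in \<open>A\<close>
  are proportional, so \<open>d\<close> is a leaf of \<open>A\<close> too and \<open>A\<close> is a star.

  If (iii) holds, then \<open>A\<^sup>3 = s A\<close> where \<open>s\<close> is the sum of the squared weights, so \<open>A\<^sup># = A / s\<close>.
\<close>

section \<open>Acyclic graphs\<close>

text \<open>Iterating \<open>step\<close> prolongs an arc to arbitrarily long walks that never turn
  back. Acyclicity makes each of them a path, and a path with \<open>n + 2\<close> vertices does not
  fit. Later arguments by infinite walks choose a suitable \<open>R\<close> and only check
  \<open>step\<close>.\<close>

lemma nonbacktracking_arcs_empty:
  assumes simple: "simple_graph n adj" and acyclic: "graph_acyclic n adj"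
    and arc: "\<And>u v. R u v \<Longrightarrow> adj u v"
    and step: "\<And>u v. R u v \<Longrightarrow> \<exists>w. R v w \<and> w \<noteq> u"
  shows "\<not> R u v"
proof
  assume R: "R u v"
  have adj: "adj i j \<Longrightarrow> i < n \<and> j < n \<and> adj j i \<and> i \<noteq> j" for i j
    using simple unfolding simple_graph_def by blast
  have "\<exists>vs. length vs = k + 2 \<and> graph_path n adj vs \<and> R (vs ! k) (vs ! Suc k)" for k
  proof (induction k)
    case 0
    have "length [u, v] = 0 + 2 \<and> graph_path n adj [u, v] \<and> R ([u, v] ! 0) ([u, v] ! Suc 0)"
      using R arc[OF R] adj by (auto simp: graph_path_def)
    then show ?case by blast
  next
    case (Suc k)
    then obtain vs where len: "length vs = k + 2" and path: "graph_path n adj vs"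
      and last: "R (vs ! k) (vs ! Suc k)" by blast
    obtain w where w: "R (vs ! Suc k) w" "w \<noteq> vs ! k" using step[OF last] by blast
    have aw: "adj (vs ! Suc k) w" using arc w by blast
    have new: "w \<notin> set vs"
    proof
      assume "w \<in> set vs"
      then obtain i where i: "i < k + 2" "vs ! i = w" using len by (auto simp: in_set_conv_nth)
      have "i \<noteq> Suc k" "i \<noteq> k" using i w(2) adj[OF aw] by auto
      then have ik: "i < k" using i by linarith
      \<comment> \<open>As \<open>w\<close> is neither the last vertex nor the one before it, the
        segment from its earlier occurrence has at least three vertices and closes up to a
        cycle.\<close>
      have "3 \<le> length (drop i vs)" using ik len by simp
      moreover have "graph_path n adj (drop i vs)"
        using path ik len unfolding graph_path_def by (auto dest: in_set_dropD)
      moreover have "last (drop i vs) = vs ! Suc k"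
        using ik len by (metis add_2_eq_Suc' diff_Suc_1 last_conv_nth last_drop length_0_conv
            less_SucI nat.distinct(1))
      moreover have "hd (drop i vs) = w" using ik len i by (simp add: hd_drop_conv_nth)
      ultimately show False using acyclic aw unfolding graph_acyclic_def by metis
    qed
    have "graph_path n adj (vs @ [w])"
      using path new len aw adj[OF aw] unfolding graph_path_def
      by (auto simp: nth_append less_Suc_eq)
    moreover have "length (vs @ [w]) = Suc k + 2" using len by simp
    moreover have "R ((vs @ [w]) ! Suc k) ((vs @ [w]) ! Suc (Suc k))"
      using len w by (simp add: nth_append)
    ultimately show ?case by blast
  qed
  from this[of n] obtain vs where vs: "length vs = n + 2" "distinct vs" "set vs \<subseteq> {..<n}"
    unfolding graph_path_def by blast
  have "card (set vs) \<le> n" using card_mono[OF _ vs(3)] by simp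
  then show False using vs distinct_card[OF vs(2)] by simp
qed

locale tree =
  fixes n :: nat and adj :: "nat \<Rightarrow> nat \<Rightarrow> bool"
  assumes tree: "is_tree n adj"
begin

lemma simple: "simple_graph n adj" and acyclic: "graph_acyclic n adj"
  using tree unfolding is_tree_def by auto

lemma adj_sym: "adj i j \<Longrightarrow> adj j i" and adj_less: "adj i j \<Longrightarrow> i < n" "adj i j \<Longrightarrow> j < n"
  and adj_irrefl: "\<not> adj i i"
  using simple unfolding simple_graph_def by blast+

lemmas nonbacktracking = nonbacktracking_arcs_empty[OF simple acyclic]

lemma no_triangle:
  assumes a: "adj x y" "adj y z" "adj z x"
  shows False
proof -
  have "graph_path n adj [x, y, z]"
    using a adj_less adj_irrefl by (auto simp: graph_path_def less_Suc_eq)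
  moreover have "3 \<le> length [x, y, z]" "last [x, y, z] = z" "hd [x, y, z] = x" by auto
  ultimately show False using acyclic a(3) unfolding graph_acyclic_def by metis
qed

lemma no_square:
  assumes a: "adj x y" "adj y z" "adj z w" "adj w x" and "x \<noteq> z" "y \<noteq> w"
  shows False
proof -
  have "graph_path n adj [x, y, z, w]"
    using assms adj_less adj_irrefl by (auto simp: graph_path_def less_Suc_eq)
  moreover have "3 \<le> length [x, y, z, w]" "last [x, y, z, w] = w" "hd [x, y, z, w] = x" by auto
  ultimately show False using acyclic a(4) unfolding graph_acyclic_def by metis
qed

lemma reachable: "i < n \<Longrightarrow> j < n \<Longrightarrow> adj\<^sup>*\<^sup>* i j"
  using tree unfolding is_tree_def graph_connected_def by blast

lemma neighbour_exists:
  assumes "2 \<le> n" "i < n"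
  shows "\<exists>j. adj i j"
proof -
  define j :: nat where "j = (if i = 0 then 1 else 0)"
  have "j < n" "j \<noteq> i" using assms by (auto simp: j_def)
  then show ?thesis using reachable[OF \<open>i < n\<close> \<open>j < n\<close>] by (metis converse_rtranclpE)
qed

text \<open>The set of \<open>c\<close> and its neighbours is closed under adjacency, so by
  connectedness it contains every vertex.\<close>

lemma is_star_if_neighbours_leaves:
  assumes "c < n" and leaf: "\<And>i j. adj c i \<Longrightarrow> adj i j \<Longrightarrow> j = c"
  shows "is_star n adj"
proof -
  have cover: "i = c \<or> adj c i" if "i < n" for i
    using reachable[OF \<open>c < n\<close> that]
  proof (induction rule: rtranclp_induct)
    case (step y z)
    then show ?case using leaf[of y z] by auto
  qed simp
  have "adj i j \<longleftrightarrow> i < n \<and> j < n \<and> i \<noteq> j \<and> (i = c \<or> j = c)" for i j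
  proof
    assume ij: "adj i j"
    then have "i = c \<or> j = c" using cover[OF adj_less(1)[OF ij]] leaf[of i j] by auto
    then show "i < n \<and> j < n \<and> i \<noteq> j \<and> (i = c \<or> j = c)" using ij adj_less adj_irrefl by auto
  next
    assume "i < n \<and> j < n \<and> i \<noteq> j \<and> (i = c \<or> j = c)"
    then show "adj i j" using cover[of i] cover[of j] adj_sym by auto
  qed
  then show ?thesis unfolding is_star_def using \<open>c < n\<close> by blast
qed

lemma finite_edges: "finite (graph_edges adj)"
proof (rule finite_subset)
  show "graph_edges adj \<subseteq> Pow {..<n}" unfolding graph_edges_def using adj_less by blast
qed simp

lemma edge_iff: "{x, y} \<in> graph_edges adj \<longleftrightarrow> adj x y"
  unfolding graph_edges_def using adj_sym by (auto simp: doubleton_eq_iff)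

text \<open>Each vertex other than \<open>0\<close> is sent to an edge towards a vertex closer to
  \<open>0\<close>. Two vertices sharing such an edge would each be closer than the other, so this
  is injective.\<close>

lemma card_edges_ge: "n - 1 \<le> card (graph_edges adj)"
proof -
  have n: "0 < n" using tree unfolding is_tree_def by simp
  define dist where "dist v = (LEAST k. (adj ^^ k) 0 v)" for v
  have dist: "(adj ^^ dist v) 0 v" if "v < n" for v
    unfolding dist_def using reachable[OF n that] by (metis LeastI rtranclp_imp_relpowp)
  have "\<exists>u. adj u v \<and> dist u < dist v" if "v \<in> {1..<n}" for v
  proof -
    have v: "v < n" "v \<noteq> 0" using that by auto
    obtain k where k: "dist v = Suc k" using dist[OF v(1)] v(2)
      by (cases "dist v") auto
    obtain u where u: "(adj ^^ k) 0 u" "adj u v" using dist[OF v(1)] k by auto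
    have "dist u \<le> k" unfolding dist_def using u(1) by (rule Least_le)
    then show ?thesis using u k by auto
  qed
  then obtain par where par: "\<And>v. v \<in> {1..<n} \<Longrightarrow> adj (par v) v \<and> dist (par v) < dist v"
    by metis
  have "inj_on (\<lambda>v. {par v, v}) {1..<n}"
    by (rule inj_onI) (metis doubleton_eq_iff par order_less_asym)
  moreover have "(\<lambda>v. {par v, v}) ` {1..<n} \<subseteq> graph_edges adj"
    using par by (auto simp: edge_iff)
  ultimately have "card {1..<n} \<le> card (graph_edges adj)"
    using card_inj_on_le finite_edges by blast
  then show ?thesis by simp
qed

section \<open>Maximum matchings and alternating paths\<close>

lemma matching_finite: "is_matching adj M \<Longrightarrow> finite M"
  unfolding is_matching_def using finite_edges finite_subset by blast

lemma matching_adj: "is_matching adj M \<Longrightarrow> {x, y} \<in> M \<Longrightarrow> adj x y"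
  unfolding is_matching_def using edge_iff by blast

lemma matching_disjoint:
  "is_matching adj M \<Longrightarrow> e \<in> M \<Longrightarrow> f \<in> M \<Longrightarrow> e \<noteq> f \<Longrightarrow> e \<inter> f = {}"
  unfolding is_matching_def by blast

lemma matching_unique:
  assumes "is_matching adj M" "{x, y} \<in> M" "{x, z} \<in> M"
  shows "y = z"
proof (rule ccontr)
  assume "y \<noteq> z"
  then have "{x, y} \<noteq> {x, z}" by (auto simp: doubleton_eq_iff)
  then have "{x, y} \<inter> {x, z} = {}" using matching_disjoint assms by blast
  then show False by simp
qed

lemma matching_covers:
  assumes "is_matching adj M"
  shows "x \<in> \<Union>M \<longleftrightarrow> (\<exists>y. {x, y} \<in> M)"
proof
  assume "x \<in> \<Union>M"
  then obtain e where e: "e \<in> M" "x \<in> e" by blast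
  then have "e \<in> graph_edges adj" using assms unfolding is_matching_def by blast
  then obtain i j where "e = {i, j}" unfolding graph_edges_def by blast
  then have "e = {x, j} \<or> e = {x, i}" using e by auto
  then show "\<exists>y. {x, y} \<in> M" using e by auto
qed auto

lemma max_matching_matching: "is_max_matching adj M \<Longrightarrow> is_matching adj M"
  unfolding is_max_matching_def by simp

lemma max_matching_exists: "\<exists>M. is_max_matching adj M"
proof -
  have "is_matching adj {}" by (simp add: is_matching_def)
  moreover have "card M < Suc (card (graph_edges adj))" if "is_matching adj M" for M
    using that card_mono[OF finite_edges] unfolding is_matching_def by (simp add: less_Suc_eq_le)
  ultimately obtain M where "is_matching adj M" "\<forall>M'. is_matching adj M' \<longrightarrow> card M' \<le> card M"
    using ex_has_greatest_nat[of "is_matching adj" "{}" card] by blast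
  then show ?thesis unfolding is_max_matching_def by blast
qed

lemma max_matching_covers_edge:
  assumes M: "is_max_matching adj M" and "adj x y"
  shows "x \<in> \<Union>M \<or> y \<in> \<Union>M"
proof (rule ccontr)
  assume no: "\<not> ?thesis"
  have m: "is_matching adj M" using M by (rule max_matching_matching)
  have "is_matching adj (insert {x, y} M)"
    using m no \<open>adj x y\<close> edge_iff unfolding is_matching_def by (auto simp: Ball_def)
  moreover have "card (insert {x, y} M) = Suc (card M)"
    using no matching_finite[OF m] by (subst card_insert_disjoint) auto
  ultimately show False using M unfolding is_max_matching_def by fastforce
qed

text \<open>Exchange along the path \<open>d\<close>, \<open>a\<close>, \<open>d'\<close>: the size
  stays the same while the missed vertex moves from \<open>d\<close> to \<open>d'\<close>.\<close>

lemma max_matching_swap: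
  assumes M: "is_max_matching adj M" and d: "d \<notin> \<Union>M" and "adj d a" and am: "{a, d'} \<in> M"
  defines "M' \<equiv> insert {a, d} (M - {{a, d'}})"
  shows "is_max_matching adj M'" and "d' \<notin> \<Union>M'"
proof -
  have m: "is_matching adj M" using M by (rule max_matching_matching)
  have dis: "e \<inter> {a, d'} = {}" if "e \<in> M" "e \<noteq> {a, d'}" for e
    using matching_disjoint[OF m that(1) am that(2)] .
  have dis': "e \<inter> {a, d} = {}" if "e \<in> M - {{a, d'}}" for e
    using dis[of e] that d by auto
  have "is_matching adj M'" unfolding is_matching_def
  proof (intro conjI ballI impI)
    show "M' \<subseteq> graph_edges adj"
      using m edge_iff[of a d] adj_sym[OF \<open>adj d a\<close>] unfolding is_matching_def M'_def by auto
    fix e f assume "e \<in> M'" "f \<in> M'" "e \<noteq> f"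
    then consider "e \<in> M - {{a, d'}}" "f = {a, d}" | "f \<in> M - {{a, d'}}" "e = {a, d}"
      | "e \<in> M" "f \<in> M" unfolding M'_def by auto
    then show "e \<inter> f = {}"
    proof cases
      case 3
      then show ?thesis using matching_disjoint[OF m] \<open>e \<noteq> f\<close> by blast
    qed (use dis'[of e] dis'[of f] in auto)
  qed
  moreover have "card M' = card M"
  proof -
    have "{a, d} \<notin> M - {{a, d'}}" using d by auto
    then show ?thesis unfolding M'_def
      using card_Suc_Diff1[OF matching_finite[OF m] am] matching_finite[OF m]
      by (simp only: card_insert_disjoint finite_Diff not_False_eq_True)
  qed
  ultimately show "is_max_matching adj M'" using M unfolding is_max_matching_def by simp
  have "d' \<noteq> d" "d' \<noteq> a" using am d matching_adj[OF m am] adj_irrefl by auto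
  then show "d' \<notin> \<Union>M'" unfolding M'_def using dis by fastforce
qed

lemma alternating_edge:
  assumes M: "is_max_matching adj M" and "{x, y} \<in> M"
  shows "{x, y} \<in> alternating_paths n adj"
proof -
  have "adj x y" using assms matching_adj max_matching_matching by blast
  then have "alternating_path n adj M [x, y]"
    using assms adj_less adj_irrefl unfolding alternating_path_def graph_path_def by auto
  then show ?thesis unfolding alternating_paths_def using M
    by (intro CollectI exI[of _ "[x, y]"]) auto
qed

text \<open>The path is \<open>[x', x, y, y']\<close>. Its ends differ, since otherwise one vertex
  would be matched to both \<open>x\<close> and \<open>y\<close>.\<close>

lemma alternating_three_edges:
  assumes M: "is_max_matching adj M"
    and m: "{x', x} \<in> M" "{y, y'} \<in> M" and xy: "adj x y" "{x, y} \<notin> M"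
  shows "{x', y'} \<in> alternating_paths n adj"
proof -
  have mm: "is_matching adj M" using M by (rule max_matching_matching)
  have ad: "adj x' x" "adj y y'" using m matching_adj[OF mm] by auto
  have "x' \<noteq> y" "x \<noteq> y'" using m xy(2) by (auto simp: insert_commute)
  moreover have "x' \<noteq> y'"
    using matching_unique[OF mm, of x' x y] m xy(1) adj_irrefl by (auto simp: insert_commute)
  ultimately have "graph_path n adj [x', x, y, y']"
    using ad xy(1) adj_less adj_irrefl unfolding graph_path_def by (auto simp: less_Suc_eq)
  then have "alternating_path n adj M [x', x, y, y']"
    using m xy(2) unfolding alternating_path_def by (auto simp: less_Suc_eq)
  then show ?thesis unfolding alternating_paths_def using M
    by (intro CollectI exI[of _ "[x', x, y, y']"]) auto
qed

lemma finite_alternating_paths: "finite (alternating_paths n adj)"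
proof (rule finite_subset)
  show "alternating_paths n adj \<subseteq> Pow {..<n}"
  proof
    fix e assume "e \<in> alternating_paths n adj"
    then obtain vs where e: "e = {hd vs, last vs}" and "graph_path n adj vs"
      unfolding alternating_paths_def alternating_path_def by blast
    then have "vs \<noteq> []" "set vs \<subseteq> {..<n}" unfolding graph_path_def by auto
    then show "e \<in> Pow {..<n}" using e hd_in_set last_in_set by blast
  qed
qed simp

section \<open>Allowed edges and the injection of edges into alternating paths\<close>

definition allowed :: "nat set \<Rightarrow> bool" where
  "allowed e \<longleftrightarrow> (\<exists>M. is_max_matching adj M \<and> e \<in> M)"

text \<open>If \<open>M\<close> missed \<open>x\<close>, it would cover \<open>y\<close>, and
  exchanging the matching edge at \<open>y\<close> for \<open>{x, y}\<close> would give a maximum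
  matching containing \<open>{x, y}\<close>.\<close>

lemma not_allowed_covered:
  assumes M: "is_max_matching adj M" and xy: "adj x y" "\<not> allowed {x, y}"
  shows "\<exists>x'. {x, x'} \<in> M"
proof (rule ccontr)
  assume no: "\<not> ?thesis"
  have m: "is_matching adj M" using M by (rule max_matching_matching)
  have x: "x \<notin> \<Union>M" using no matching_covers[OF m] by blast
  then obtain y' where "{y, y'} \<in> M"
    using max_matching_covers_edge[OF M xy(1)] matching_covers[OF m] by blast
  from max_matching_swap(1)[OF M x xy(1) this] show False
    using xy(2) unfolding allowed_def by (metis insertCI insert_commute)
qed

definition mate :: "nat set set \<Rightarrow> nat \<Rightarrow> nat" where
  "mate M x = (THE y. {x, y} \<in> M)"

lemma mate_eq: "is_matching adj M \<Longrightarrow> {x, y} \<in> M \<Longrightarrow> mate M x = y"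
  unfolding mate_def using matching_unique by blast

text \<open>An edge in some maximum matching is itself an alternating path; any other edge has both
  ends matched by \<open>M\<close>, and is the middle edge of an alternating path with three edges.\<close>
definition edge_path :: "nat set set \<Rightarrow> nat set \<Rightarrow> nat set" where
  "edge_path M e = (if allowed e then e else mate M ` e)"

text \<open>Elimination rule for the two branches of \<open>edge_path\<close>. In the second branch,
  \<open>x' \<noteq> y\<close> and \<open>x \<noteq> y'\<close> record that the edge is not in
  \<open>M\<close>.\<close>

lemma edge_path_cases:
  assumes M: "is_max_matching adj M" and e: "e \<in> graph_edges adj"
  obtains (allowed) x y where "e = {x, y}" "adj x y" "allowed e" "edge_path M e = e"
  | (blocked) x y x' y' where "e = {x, y}" "adj x y" "\<not> allowed e" "{x, x'} \<in> M" "{y, y'} \<in> M"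
      "edge_path M e = {x', y'}" "x' \<noteq> y" "x \<noteq> y'"
proof -
  have m: "is_matching adj M" using M by (rule max_matching_matching)
  obtain x y where xy: "e = {x, y}" "adj x y" using e unfolding graph_edges_def by blast
  show ?thesis
  proof (cases "allowed e")
    case True
    then show ?thesis using allowed xy unfolding edge_path_def by simp
  next
    case False
    obtain x' y' where x'y': "{x, x'} \<in> M" "{y, y'} \<in> M"
      using not_allowed_covered[OF M] xy adj_sym False by (metis insert_commute)
    moreover have "edge_path M e = {x', y'}"
      using False xy mate_eq[OF m] x'y' unfolding edge_path_def by auto
    moreover have "x' \<noteq> y" "x \<noteq> y'" using x'y' False M xy unfolding allowed_def
      by (auto simp: insert_commute)
    ultimately show ?thesis using blocked xy False by blast
  qed
qed

lemma edge_path_alternating: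
  assumes M: "is_max_matching adj M" and e: "e \<in> graph_edges adj"
  shows "edge_path M e \<in> alternating_paths n adj"
  using M e
proof (cases rule: edge_path_cases)
  case (allowed x y)
  then show ?thesis using alternating_edge unfolding allowed_def by metis
next
  case (blocked x y x' y')
  then have "{x, y} \<notin> M" using M unfolding allowed_def by auto
  then show ?thesis
    using alternating_three_edges[OF M _ blocked(5) blocked(2), of x'] blocked
    by (simp add: insert_commute)
qed

text \<open>An edge between the two mates would close \<open>x'\<close>, \<open>x\<close>,
  \<open>y\<close>, \<open>y'\<close> to a 4-cycle. This separates the images of edges that are not
  allowed from those of allowed ones.\<close>

lemma edge_path_not_edge:
  assumes M: "is_max_matching adj M" and e: "e \<in> graph_edges adj" "\<not> allowed e"
  shows "edge_path M e \<notin> graph_edges adj"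
  using M e(1)
proof (cases rule: edge_path_cases)
  case (blocked x y x' y')
  have m: "is_matching adj M" using M by (rule max_matching_matching)
  have "adj x' x" "adj y y'" using blocked matching_adj[OF m] adj_sym by blast+
  then show ?thesis
    using no_square[of x' x y y'] blocked edge_iff adj_sym by metis
qed (use e in simp)

text \<open>On allowed edges the map is the identity; on the others it is the image under
  \<open>mate M\<close>, which is injective on covered vertices. The two kinds of images never meet,
  because only the first are edges.\<close>

lemma edge_path_inj:
  assumes M: "is_max_matching adj M"
  shows "inj_on (edge_path M) (graph_edges adj)"
proof (rule inj_onI)
  have m: "is_matching adj M" using M by (rule max_matching_matching)
  fix e f assume e: "e \<in> graph_edges adj" and f: "f \<in> graph_edges adj"
    and eq: "edge_path M e = edge_path M f"
  consider "allowed e" "allowed f" | "allowed e \<noteq> allowed f" | "\<not> allowed e" "\<not> allowed f" by blast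
  then show "e = f"
  proof cases
    case 1
    then show ?thesis using eq by (simp add: edge_path_def)
  next
    case 2
    then show ?thesis using edge_path_not_edge[OF M] e f eq by (metis edge_path_def)
  next
    case 3
    have inj: "inj_on (mate M) (\<Union>M)"
      by (rule inj_onI) (metis insert_commute m mate_eq matching_covers matching_unique)
    have "g \<subseteq> \<Union>M" if "g \<in> graph_edges adj" "\<not> allowed g" for g
      using M that(1) by (cases rule: edge_path_cases) (use that matching_covers[OF m] in auto)
    then show ?thesis using inj_on_image_eq_iff[OF inj] e f 3 eq unfolding edge_path_def by simp
  qed
qed

section \<open>Alternating paths beyond the image of the edges\<close>

lemma card_alternating_paths_gt:
  assumes M: "is_max_matching adj M" and z: "z \<in> alternating_paths n adj"
    and new: "z \<notin> edge_path M ` graph_edges adj"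
  shows "n - 1 < card (alternating_paths n adj)"
proof -
  let ?I = "edge_path M ` graph_edges adj"
  have "n - 1 < card (insert z ?I)"
    using new card_edges_ge card_image[OF edge_path_inj[OF M]] finite_edges by simp
  also have "\<dots> \<le> card (alternating_paths n adj)"
    using z edge_path_alternating[OF M] by (intro card_mono finite_alternating_paths) auto
  finally show ?thesis .
qed

text \<open>With \<open>d1\<close>, \<open>d2\<close> the mates of \<open>a1\<close>,
  \<open>a2\<close>, exchanging \<open>{a2, d2}\<close> for \<open>{a2, d}\<close> makes
  \<open>d1\<close>, \<open>a1\<close>, \<open>d\<close>, \<open>a2\<close> alternating. If its pair
  of ends were in the image of \<open>edge_path M\<close>, a 4-cycle through \<open>d1\<close>,
  \<open>a1\<close>, \<open>d\<close>, \<open>a2\<close> or through \<open>a1\<close>,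
  \<open>d\<close>, \<open>a2\<close>, \<open>d2\<close> would arise.\<close>

lemma card_gt_if_uncovered_nonleaf:
  assumes M: "is_max_matching adj M" and d: "d \<notin> \<Union>M"
    and a: "adj d a1" "adj d a2" "a1 \<noteq> a2"
  shows "n - 1 < card (alternating_paths n adj)"
proof -
  have m: "is_matching adj M" using M by (rule max_matching_matching)
  obtain d1 d2 where m1: "{a1, d1} \<in> M" and m2: "{a2, d2} \<in> M"
    using max_matching_covers_edge[OF M] a d matching_covers[OF m] by metis
  have dd: "d1 \<noteq> d" "d2 \<noteq> d" using d m1 m2 by auto
  let ?M = "insert {a2, d} (M - {{a2, d2}})"
  have M': "is_max_matching adj ?M" using max_matching_swap[OF M d a(2) m2] by simp
  \<comment> \<open>If the two matching edges coincided, \<open>a1\<close> and \<open>a2\<close>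
    would be adjacent and form a triangle with \<open>d\<close>.\<close>
  have "{a1, d1} \<noteq> {a2, d2}"
    using matching_adj[OF m m1] a no_triangle[OF a(1), of a2] adj_sym by (auto simp: doubleton_eq_iff)
  then have in1: "{d1, a1} \<in> ?M" using m1 by (simp add: insert_commute)
  have "{a1, d} \<notin> ?M" using a(3) d dd by (auto simp: doubleton_eq_iff)
  then have alt: "{d1, a2} \<in> alternating_paths n adj"
    using alternating_three_edges[OF M' in1 _ adj_sym[OF a(1)]] by (simp add: insert_commute)
  have ad: "adj d1 a1" "adj a2 d2" using m1 m2 matching_adj[OF m] adj_sym by blast+
  have "{d1, a2} \<notin> edge_path M ` graph_edges adj"
  proof
    assume "{d1, a2} \<in> edge_path M ` graph_edges adj"
    then obtain e where e: "e \<in> graph_edges adj" "{d1, a2} = edge_path M e" by blast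
    have no1: "\<not> adj d1 a2" using no_square[OF ad(1) adj_sym[OF a(1)] a(2)] dd a(3) adj_sym by blast
    have no2: "\<not> adj a1 d2" using no_square[OF adj_sym[OF a(1)] a(2) ad(2)] dd a(3) adj_sym by blast
    \<comment> \<open>An edge whose ends have mates \<open>d1\<close> and \<open>a2\<close> can only
      join \<open>a1\<close> to \<open>d2\<close>.\<close>
    have *: "adj a1 d2" if "{x, d1} \<in> M" "{y, a2} \<in> M" "adj x y" for x y
      using that m1 m2 matching_unique[OF m] by (metis insert_commute)
    show False using M e(1)
    proof (cases rule: edge_path_cases)
      case (allowed x y)
      then show False using e edge_iff no1 by metis
    next
      case (blocked x y x' y')
      then have "{d1, a2} = {x', y'}" using e by simp
      then show False using *[of x y] *[of y x] blocked adj_sym no2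
        by (auto simp: doubleton_eq_iff)
    qed
  qed
  then show ?thesis using card_alternating_paths_gt[OF M alt] by blast
qed

text \<open>Exchanging the matching edge at \<open>a\<close> for \<open>{a, d}\<close> makes
  \<open>d\<close>, \<open>a\<close>, \<open>y\<close>, \<open>y'\<close> alternating. Its pair of
  ends is not an edge, for lack of 4-cycles, and it is not a pair of mates under \<open>M\<close>,
  since \<open>M\<close> misses \<open>d\<close>.\<close>

lemma card_gt_if_blocked_edge:
  assumes M: "is_max_matching adj M" and d: "d \<notin> \<Union>M"
    and da: "adj d a" and ay: "adj a y" "\<not> allowed {a, y}"
  shows "n - 1 < card (alternating_paths n adj)"
proof -
  have m: "is_matching adj M" using M by (rule max_matching_matching)
  obtain d' where ad': "{a, d'} \<in> M"
    using max_matching_covers_edge[OF M da] d matching_covers[OF m] by metis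
  obtain y' where yy': "{y, y'} \<in> M"
    using not_allowed_covered[OF M adj_sym[OF ay(1)]] ay(2) by (auto simp: insert_commute)
  let ?M = "insert {a, d} (M - {{a, d'}})"
  have M': "is_max_matching adj ?M" using max_matching_swap[OF M d da ad'] by simp
  have no: "{a, y} \<notin> M" "{a, y} \<notin> ?M" using ay(2) M M' unfolding allowed_def by blast+
  have "y \<noteq> d" using no by auto
  have "y' \<noteq> a" using no yy' by (auto simp: insert_commute)
  have "{y, y'} \<noteq> {a, d'}" using no ad' \<open>y' \<noteq> a\<close> ay(1) adj_irrefl by (auto simp: doubleton_eq_iff)
  then have alt: "{d, y'} \<in> alternating_paths n adj"
    using alternating_three_edges[OF M' _ _ ay(1) no(2), of d y'] yy' by (simp add: insert_commute)
  have "{d, y'} \<notin> edge_path M ` graph_edges adj"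
  proof
    assume "{d, y'} \<in> edge_path M ` graph_edges adj"
    then obtain e where e: "e \<in> graph_edges adj" "{d, y'} = edge_path M e" by blast
    have "\<not> adj d y'" using no_square[OF da ay(1) matching_adj[OF m yy']]
        adj_sym \<open>y \<noteq> d\<close> \<open>y' \<noteq> a\<close> by blast
    show False using M e(1)
    proof (cases rule: edge_path_cases)
      case (allowed x y)
      then show False using e edge_iff \<open>\<not> adj d y'\<close> by metis
    next
      case (blocked x y x' y')
      then have "d \<in> {x', y'}" using e by blast
      then show False using d blocked by blast
    qed
  qed
  then show ?thesis using card_alternating_paths_gt[OF M alt] by blast
qed

text \<open>All edges meet in the centre, so every single edge is a maximum matching. A path on four
  or more vertices would contain two disjoint edges, hence the alternating paths are exactly the
  edges.\<close>

lemma card_alternating_paths_star: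
  assumes "is_star n adj"
  shows "card (alternating_paths n adj) = n - 1"
proof -
  obtain c where c: "c < n" and star: "\<And>i j. adj i j \<longleftrightarrow> i < n \<and> j < n \<and> i \<noteq> j \<and> (i = c \<or> j = c)"
    using assms unfolding is_star_def by blast
  have starD: "i = c \<or> j = c" if "adj i j" for i j using that star[of i j] by simp
  have starI: "adj c v" if "v < n" "v \<noteq> c" for v using that star[of c v] c by simp
  have centre: "c \<in> e" if "e \<in> graph_edges adj" for e
    using that unfolding graph_edges_def by (auto dest: starD)
  have small: "card M \<le> 1" if M: "is_matching adj M" for M
  proof -
    have "e = f" if "e \<in> M" "f \<in> M" for e f
    proof (rule ccontr)
      assume "e \<noteq> f"
      then have "e \<inter> f = {}" using matching_disjoint[OF M that] by blast
      moreover have "c \<in> e" "c \<in> f" using centre M that unfolding is_matching_def by auto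
      ultimately show False by blast
    qed
    then show ?thesis using matching_finite[OF M] by (simp add: card_le_Suc0_iff_eq)
  qed
  have "alternating_paths n adj = (\<lambda>v. {c, v}) ` ({..<n} - {c})"
  proof (intro equalityI subsetI)
    fix e assume "e \<in> alternating_paths n adj"
    then obtain vs where e: "e = {hd vs, last vs}" and path: "graph_path n adj vs" and ev: "even (length vs)"
      unfolding alternating_paths_def alternating_path_def by blast
    have "\<not> 4 \<le> length vs"
    proof
      assume l: "4 \<le> length vs"
      have "adj (vs ! i) (vs ! Suc i)" if "i < 3" for i
        using path that l unfolding graph_path_def by simp
      from this[of 0] this[of 2] have "vs ! 0 = c \<or> vs ! 1 = c" "vs ! 2 = c \<or> vs ! 3 = c"
        by (auto dest!: starD simp: numeral_3_eq_3 numeral_2_eq_2)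
      moreover have "distinct vs" using path unfolding graph_path_def by simp
      moreover have "0 < length vs" "1 < length vs" "2 < length vs" "3 < length vs" using l by auto
      ultimately show False using nth_eq_iff_index_eq[of vs]
        by (metis numeral_eq_iff numeral_eq_one_iff semiring_norm(83,86,88,89) zero_neq_numeral)
    qed
    moreover have "2 \<le> length vs" using path unfolding graph_path_def by simp
    ultimately have "length vs = 2" using ev by presburger
    then obtain x y where vs: "vs = [x, y]"
      by (metis (no_types, lifting) One_nat_def Suc_1 length_0_conv length_Suc_conv)
    then have "adj x y" using path unfolding graph_path_def by simp
    then show "e \<in> (\<lambda>v. {c, v}) ` ({..<n} - {c})" using starD[of x y] adj_less adj_irrefl e vs by auto
  next
    fix e assume "e \<in> (\<lambda>v. {c, v}) ` ({..<n} - {c})"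
    then obtain v where v: "v < n" "v \<noteq> c" "e = {c, v}" by blast
    have "is_matching adj {e}" using v starI edge_iff unfolding is_matching_def by simp
    then have "is_max_matching adj {e}" using small unfolding is_max_matching_def by simp
    then show "e \<in> alternating_paths n adj" using alternating_edge[of "{e}" c v] v by simp
  qed
  moreover have "inj_on (\<lambda>v. {c, v}) ({..<n} - {c})" by (rule inj_onI) (auto simp: doubleton_eq_iff)
  ultimately show ?thesis using c by (simp add: card_image)
qed

text \<open>The count rules out both constructions of a surplus path, so every vertex missed by some
  maximum matching is a leaf. The neighbour \<open>a\<close> of \<open>d\<close> is the centre: each
  neighbour of \<open>a\<close> is shown to be missed by some maximum matching.\<close>

lemma is_star_if_card_alternating_paths:
  assumes M: "is_max_matching adj M" and d: "d < n" "d \<notin> \<Union>M" and "2 \<le> n"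
    and card: "card (alternating_paths n adj) = n - 1"
  shows "is_star n adj"
proof -
  have leaf: "x = y" if "is_max_matching adj M'" "v \<notin> \<Union>M'" "adj v x" "adj v y" for M' v x y
    using card_gt_if_uncovered_nonleaf[OF that] card by auto
  obtain a where da: "adj d a" using neighbour_exists[OF \<open>2 \<le> n\<close> d(1)] by blast
  show ?thesis
  proof (rule is_star_if_neighbours_leaves)
    show "a < n" using da adj_less by blast
    fix y z assume ay: "adj a y" and yz: "adj y z"
    have "allowed {a, y}" using card_gt_if_blocked_edge[OF M d(2) da ay] card by auto
    then obtain M3 where M3: "is_max_matching adj M3" "{a, y} \<in> M3" unfolding allowed_def by blast
    have m3: "is_matching adj M3" using M3(1) by (rule max_matching_matching)
    show "z = a"
    proof (cases "y = d")
      case True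
      then show ?thesis using leaf[OF M d(2)] yz da by blast
    next
      case False
      \<comment> \<open>The only neighbour \<open>a\<close> of the leaf \<open>d\<close> is matched
        to \<open>y\<close> in \<open>M3\<close>. Exchanging \<open>{a, y}\<close> for
        \<open>{a, d}\<close> then leaves \<open>y\<close> missed, hence a leaf.\<close>
      have "d \<notin> \<Union>M3"
      proof
        assume "d \<in> \<Union>M3"
        then obtain w where w: "{d, w} \<in> M3" using matching_covers[OF m3] by blast
        then have "w = a" using leaf[OF M d(2)] da matching_adj[OF m3] by blast
        then show False using w M3(2) False matching_unique[OF m3] by (metis insert_commute)
      qed
      from max_matching_swap[OF M3(1) this da M3(2)] show ?thesis
        using leaf yz adj_sym[OF ay] by blast
    qed
  qed
qed

end

section \<open>Finite sums, and kernel vectors in the presence of a perfect matching\<close>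

lemma sum_zero_other_nonzero:
  fixes f :: "nat \<Rightarrow> real"
  assumes "(\<Sum>j<n. f j) = 0" "i < n" "f i \<noteq> 0"
  shows "\<exists>j<n. j \<noteq> i \<and> f j \<noteq> 0"
proof (rule ccontr)
  assume "\<not> ?thesis"
  then have "(\<Sum>j<n. f j) = f i"
    using assms(2) by (subst sum.remove[of _ i]) (auto intro: sum.neutral)
  then show False using assms by simp
qed

lemma sum_eq_single:
  fixes f :: "nat \<Rightarrow> real"
  assumes "i < n" "\<And>j. j < n \<Longrightarrow> j \<noteq> i \<Longrightarrow> f j = 0"
  shows "(\<Sum>j<n. f j) = f i"
  using assms by (subst sum.remove[of _ i]) (auto intro: sum.neutral)

lemma sum_mult_assoc:
  fixes a b c :: "nat \<Rightarrow> nat \<Rightarrow> real"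
  shows "(\<Sum>k<n. (\<Sum>l<n. a i l * b l k) * c k j) = (\<Sum>l<n. a i l * (\<Sum>k<n. b l k * c k j))"
  by (simp add: sum_distrib_left sum_distrib_right mult.assoc) (rule sum.swap)

context tree
begin

text \<open>Where \<open>v\<close> is nonzero, walk along the matching edge; the kernel equation at
  its other end gives a further neighbour where \<open>v\<close> is nonzero, and the walk continues
  there without turning back.\<close>

lemma kernel_zero_if_perfect_matching:
  fixes a :: "nat \<Rightarrow> nat \<Rightarrow> real" and v :: "nat \<Rightarrow> real"
  assumes support: "\<And>i j. i < n \<Longrightarrow> j < n \<Longrightarrow> a i j \<noteq> 0 \<longleftrightarrow> adj i j"
    and kernel: "\<And>i. i < n \<Longrightarrow> (\<Sum>j<n. a i j * v j) = 0"
    and M: "is_matching adj M" and perfect: "\<And>i. i < n \<Longrightarrow> i \<in> \<Union>M"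
    and i: "i < n"
  shows "v i = 0"
proof (rule ccontr)
  assume "v i \<noteq> 0"
  define R where "R u w \<longleftrightarrow> adj u w \<and> ({u, w} \<in> M \<and> v u \<noteq> 0 \<or> {u, w} \<notin> M \<and> v w \<noteq> 0)" for u w
  have "\<exists>z. R w z \<and> z \<noteq> u" if R: "R u w" for u w
  proof (cases "{u, w} \<in> M")
    case True
    have u: "u < n" "w < n" "adj w u" using R adj_less adj_sym unfolding R_def by blast+
    have "v u \<noteq> 0" using R True unfolding R_def by simp
    then have "a w u * v u \<noteq> 0" using support u by simp
    then obtain z where z: "z < n" "z \<noteq> u" "a w z * v z \<noteq> 0"
      using sum_zero_other_nonzero[OF kernel[OF u(2)] u(1)] by blast
    then have "adj w z" "v z \<noteq> 0" using support[of w z] u by auto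
    moreover have "{w, z} \<notin> M" using matching_unique[OF M, of w u z] True z(2) by (auto simp: insert_commute)
    ultimately show ?thesis using z(2) unfolding R_def by blast
  next
    case False
    have w: "w < n" "v w \<noteq> 0" using R False adj_less unfolding R_def by blast+
    then obtain z where z: "{w, z} \<in> M" using perfect matching_covers[OF M] by blast
    then have "z \<noteq> u" using False by (auto simp: insert_commute)
    moreover have "adj w z" using matching_adj[OF M z] .
    ultimately show ?thesis using z w(2) unfolding R_def by blast
  qed
  then have "\<not> R u w" for u w
    by (intro nonbacktracking[of R]) (auto simp: R_def)
  moreover obtain z where "{i, z} \<in> M" using perfect[OF i] matching_covers[OF M] by blast
  then have "R i z" using matching_adj[OF M] \<open>v i \<noteq> 0\<close> unfolding R_def by blast
  ultimately show False by blast
qed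

end

section \<open>Two trees whose weighted adjacency matrices are group inverses of each other\<close>

text \<open>Entries are given as functions and the assumptions are symmetric in \<open>a\<close> and
  \<open>b\<close> up to commutation. Singularity enters as \<open>not_inverse\<close>: the product
  of the two matrices is not the identity.\<close>

locale inverse_trees =
  fixes n :: nat and a b :: "nat \<Rightarrow> nat \<Rightarrow> real"
  assumes n: "2 \<le> n"
    and tree_a: "is_tree n (\<lambda>i j. i < n \<and> j < n \<and> a i j \<noteq> 0)"
    and tree_b: "is_tree n (\<lambda>i j. i < n \<and> j < n \<and> b i j \<noteq> 0)"
    and sym_a: "i < n \<Longrightarrow> j < n \<Longrightarrow> a i j = a j i"
    and sym_b: "i < n \<Longrightarrow> j < n \<Longrightarrow> b i j = b j i"
    and comm: "i < n \<Longrightarrow> j < n \<Longrightarrow> (\<Sum>k<n. a i k * b k j) = (\<Sum>k<n. b i k * a k j)"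
    and aba: "i < n \<Longrightarrow> j < n \<Longrightarrow> (\<Sum>l<n. (\<Sum>k<n. a i k * b k l) * a l j) = a i j"
    and bab: "i < n \<Longrightarrow> j < n \<Longrightarrow> (\<Sum>l<n. (\<Sum>k<n. b i k * a k l) * b l j) = b i j"
    and not_inverse: "\<exists>i<n. \<exists>j<n. (\<Sum>k<n. a i k * b k j) \<noteq> (if i = j then 1 else 0)"
begin

sublocale A: tree n "\<lambda>i j. i < n \<and> j < n \<and> a i j \<noteq> 0"
  using tree_a by unfold_locales

sublocale B: tree n "\<lambda>i j. i < n \<and> j < n \<and> b i j \<noteq> 0"
  using tree_b by unfold_locales

text \<open>Every result about \<open>a\<close> and \<open>b\<close> becomes available with the
  roles exchanged; \<open>p_dual\<close> and \<open>D_dual\<close> keep \<open>p\<close> and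
  \<open>D\<close> fixed under the exchange.\<close>

lemma dual: "inverse_trees n b a"
proof
  show "\<exists>i<n. \<exists>j<n. (\<Sum>k<n. b i k * a k j) \<noteq> (if i = j then 1 else 0)"
    using not_inverse comm by metis
qed (fact n tree_a tree_b sym_a sym_b comm[symmetric] aba bab)+

definition p :: "nat \<Rightarrow> nat \<Rightarrow> real" where
  "p i j = (\<Sum>k<n. a i k * b k j)"

text \<open>\<open>p\<close> is the orthogonal projection onto the common range, so \<open>D\<close> consists of the vertices at
  which some kernel vector does not vanish.\<close>
definition D :: "nat set" where
  "D = {i. i < n \<and> p i i \<noteq> 1}"

lemma p_dual: "i < n \<Longrightarrow> j < n \<Longrightarrow> inverse_trees.p n b a i j = p i j"
  using comm unfolding p_def inverse_trees.p_def[OF dual] by simp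

lemma D_dual: "inverse_trees.D n b a = D"
  unfolding D_def inverse_trees.D_def[OF dual] using p_dual by auto

lemma D_less: "i \<in> D \<Longrightarrow> i < n"
  unfolding D_def by simp

lemma p_sym:
  assumes "i < n" "j < n"
  shows "p i j = p j i"
proof -
  have "p i j = (\<Sum>k<n. b j k * a k i)"
    unfolding p_def using sym_a sym_b assms by (intro sum.cong) (auto simp: mult.commute)
  then show ?thesis using comm[OF assms(2,1)] unfolding p_def by simp
qed

lemma p_a: "i < n \<Longrightarrow> j < n \<Longrightarrow> (\<Sum>l<n. p i l * a l j) = a i j"
  unfolding p_def by (rule aba)

lemma a_p: "i < n \<Longrightarrow> j < n \<Longrightarrow> (\<Sum>l<n. a i l * p l j) = a i j"
  using p_a[of j i] sym_a[of i j] sym_a p_sym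
  by (smt (verit, ccfv_SIG) lessThan_iff mult.commute sum.cong)

lemma p_b: "i < n \<Longrightarrow> j < n \<Longrightarrow> (\<Sum>l<n. p i l * b l j) = b i j"
  using bab[of i j] comm[of i] unfolding p_def by simp

lemma p_idem:
  assumes "i < n" "j < n"
  shows "(\<Sum>l<n. p i l * p l j) = p i j"
proof -
  have "(\<Sum>l<n. p i l * p l j) = (\<Sum>k<n. (\<Sum>l<n. p i l * a l k) * b k j)"
    unfolding p_def[of _ j] by (rule sum_mult_assoc[symmetric])
  also have "\<dots> = p i j" using p_a[OF assms(1)] unfolding p_def[of i j] by simp
  finally show ?thesis .
qed

lemma p_sum_squares: "i < n \<Longrightarrow> (\<Sum>l<n. (p i l)\<^sup>2) = p i i"
  using p_idem[of i i] p_sym by (simp add: power2_eq_square)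

text \<open>The squares in row \<open>i\<close> sum to \<open>p i i\<close>. When this is 1, the
  diagonal entry alone exhausts the sum.\<close>

lemma p_outside:
  assumes "i < n" "i \<notin> D" "j < n" "j \<noteq> i"
  shows "p i j = 0"
proof -
  have "p i i = 1" using assms unfolding D_def by simp
  moreover have "(\<Sum>l<n. (p i l)\<^sup>2) = (p i i)\<^sup>2 + (\<Sum>l\<in>{..<n} - {i}. (p i l)\<^sup>2)"
    using assms by (subst sum.remove[of _ i]) auto
  ultimately have "(\<Sum>l\<in>{..<n} - {i}. (p i l)\<^sup>2) = 0" using p_sum_squares[OF assms(1)] by simp
  then show ?thesis using assms by (subst (asm) sum_nonneg_eq_0_iff) auto
qed

lemma p_outside': "i < n \<Longrightarrow> j \<notin> D \<Longrightarrow> j < n \<Longrightarrow> j \<noteq> i \<Longrightarrow> p i j = 0"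
  using p_outside[of j i] p_sym by simp

text \<open>Column \<open>i\<close> of the identity minus \<open>p\<close> lies in the kernel of
  \<open>a\<close> and is nonzero at \<open>i\<close>. Row \<open>k\<close> of the kernel equation
  therefore needs a second nonzero term, and its index has a nonzero off-diagonal entry of
  \<open>p\<close>.\<close>

lemma second_D_neighbour:
  assumes "i \<in> D" "k < n" "a k i \<noteq> 0"
  shows "\<exists>j\<in>D. j \<noteq> i \<and> a k j \<noteq> 0"
proof -
  have i: "i < n" using assms D_less by simp
  let ?q = "\<lambda>j. (if j = i then 1 else 0) - p j i"
  have "(\<Sum>j<n. a k j * ?q j) = (\<Sum>j<n. a k j * (if j = i then 1 else 0)) - (\<Sum>j<n. a k j * p j i)"
    by (simp add: right_diff_distrib sum_subtractf)
  also have "\<dots> = 0"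
    using a_p[OF assms(2) i] i by (simp add: if_distrib[of "\<lambda>x. _ * x"] cong: if_cong)
  finally have s: "(\<Sum>j<n. a k j * ?q j) = 0" .
  have "a k i * ?q i \<noteq> 0" using assms unfolding D_def by simp
  then obtain j where j: "j < n" "j \<noteq> i" "a k j * ?q j \<noteq> 0"
    using sum_zero_other_nonzero[OF s i] by blast
  then have "a k j \<noteq> 0" "p j i \<noteq> 0" by auto
  then show ?thesis using j p_outside[of j i] i by blast
qed

text \<open>A nonzero \<open>b k y\<close> would start an endless walk in \<open>a\<close> whose
  arcs have one end in \<open>D\<close> and the other in the support of column \<open>y\<close> of
  \<open>b\<close>. It is continued alternately by \<open>p v y = 0\<close> and by
  \<open>second_D_neighbour\<close>.\<close>

lemma b_vanishes:
  assumes "k < n" "i \<in> D" "a k i \<noteq> 0" "y < n" "y \<notin> D"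
  shows "b k y = 0"
proof (rule ccontr)
  assume bk: "b k y \<noteq> 0"
  define R where "R u v \<longleftrightarrow> (u < n \<and> v < n \<and> a u v \<noteq> 0) \<and> (v \<in> D \<and> b u y \<noteq> 0 \<or> u \<in> D \<and> b v y \<noteq> 0)" for u v
  have "\<exists>w. R v w \<and> w \<noteq> u" if R: "R u v" for u v
  proof -
    have uv: "u < n" "v < n" "a u v \<noteq> 0" "a v u \<noteq> 0" using R sym_a unfolding R_def by auto
    consider "v \<in> D" "b u y \<noteq> 0" | "u \<in> D" "b v y \<noteq> 0" using R unfolding R_def by blast
    then show ?thesis
    proof cases
      case 1
      then have "(\<Sum>w<n. a v w * b w y) = 0"
        using p_outside'[of v y] uv assms unfolding p_def by blast
      then obtain w where "w < n" "w \<noteq> u" "a v w * b w y \<noteq> 0"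
        using sum_zero_other_nonzero[of "\<lambda>w. a v w * b w y" n u] uv 1 by auto
      then show ?thesis using 1 uv unfolding R_def by auto
    next
      case 2
      then obtain w where "w \<in> D" "w \<noteq> u" "a v w \<noteq> 0"
        using second_D_neighbour[of u v] uv by blast
      then show ?thesis using 2 uv D_less unfolding R_def by auto
    qed
  qed
  then have "\<not> R u v" for u v by (intro A.nonbacktracking[of R]) (auto simp: R_def)
  moreover have "R k i" using assms bk D_less unfolding R_def by auto
  ultimately show False by blast
qed

text \<open>Some neighbour of \<open>k\<close> in \<open>b\<close> exists, and it cannot lie outside
  \<open>D\<close>. Being next to \<open>D\<close> thus carries over from \<open>a\<close> to
  \<open>b\<close>, which allows \<open>b_vanishes\<close> to be applied in its dual form.\<close>

lemma D_neighbour_dual: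
  assumes "k < n" "i \<in> D" "a k i \<noteq> 0"
  shows "\<exists>j\<in>D. b k j \<noteq> 0"
  using B.neighbour_exists[OF n assms(1)] b_vanishes[OF assms] by blast

lemma neighbours_in_D:
  assumes "k < n" "i \<in> D" "a k i \<noteq> 0" "y < n" "a k y \<noteq> 0"
  shows "y \<in> D"
proof (rule ccontr)
  assume y: "y \<notin> D"
  obtain j where "j \<in> D" "b k j \<noteq> 0" using D_neighbour_dual[OF assms(1-3)] by blast
  then have "a k y = 0"
    using inverse_trees.b_vanishes[OF dual, of k j y] D_dual y assms by simp
  then show False using assms by simp
qed

section \<open>Leaves and the extremal vertex\<close>

definition leaf_at :: "nat \<Rightarrow> nat \<Rightarrow> bool" where
  "leaf_at i k \<longleftrightarrow> (\<forall>j<n. a i j \<noteq> 0 \<longrightarrow> j = k)"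

lemma leaf_p: "i < n \<Longrightarrow> k < n \<Longrightarrow> leaf_at i k \<Longrightarrow> p i j = a i k * b k j"
  unfolding p_def leaf_at_def by (rule sum_eq_single) auto

text \<open>Row \<open>i\<close> of \<open>p\<close> is a multiple of row \<open>k\<close> of
  \<open>b\<close>, and \<open>p\<close> fixes \<open>b\<close>. Hence the leaves of
  \<open>a\<close> at \<open>k\<close> have proportional rows in \<open>b\<close>, each a multiple
  of row \<open>k\<close> of the square of \<open>b\<close>.\<close>

lemma leaf_b:
  assumes "i < n" "j < n" "k < n" "leaf_at i k"
  shows "b i j = a i k * (\<Sum>l<n. b k l * b l j)"
  using p_b[OF assms(1,2)] leaf_p[OF assms(1,3,4)] by (simp add: sum_distrib_left mult.assoc)

text \<open>Otherwise every vertex next to \<open>D\<close> has, apart from any given neighbour,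
  another one that is not a leaf at it. By \<open>neighbours_in_D\<close> that one is again in
  \<open>D\<close>, so a walk that never turns back could be continued forever.\<close>

lemma extremal_vertex:
  "\<exists>k<n. \<exists>i\<in>D. a k i \<noteq> 0 \<and> (\<exists>d. \<forall>j<n. a k j \<noteq> 0 \<longrightarrow> j \<noteq> d \<longrightarrow> leaf_at j k)"
proof (rule ccontr)
  assume no: "\<not> ?thesis"
  define R where "R u v \<longleftrightarrow> (u < n \<and> v < n \<and> a u v \<noteq> 0) \<and> (u \<in> D \<or> v \<in> D \<and> \<not> leaf_at v u)" for u v
  have "\<exists>w. R v w \<and> w \<noteq> u" if R: "R u v" for u v
  proof -
    have uv: "u < n" "v < n" "a u v \<noteq> 0" "a v u \<noteq> 0" using R sym_a unfolding R_def by auto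
    consider "u \<in> D" | "v \<in> D" "\<not> leaf_at v u" using R unfolding R_def by blast
    then show ?thesis
    proof cases
      case 1
      then obtain w where w: "w < n" "a v w \<noteq> 0" "w \<noteq> u" "\<not> leaf_at w v" using no uv by blast
      then have "w \<in> D" using neighbours_in_D[of v u w] uv 1 by simp
      then show ?thesis using w uv unfolding R_def by blast
    next
      case 2
      then obtain w where "w < n" "a v w \<noteq> 0" "w \<noteq> u" unfolding leaf_at_def by blast
      then show ?thesis using 2 uv unfolding R_def by blast
    qed
  qed
  then have *: "\<not> R u v" for u v by (intro A.nonbacktracking[of R]) (auto simp: R_def)
  \<comment> \<open>The set \<open>D\<close> is not empty: outside it the rows of \<open>p\<close>
    are those of the identity, but \<open>p\<close> is not the identity.\<close>
  obtain i j where ij: "i < n" "j < n" "p i j \<noteq> (if i = j then 1 else 0)"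
    using not_inverse unfolding p_def by blast
  then have "i \<in> D" using p_outside[of i j] unfolding D_def by (auto split: if_splits)
  then have i: "i < n" "i \<in> D" using ij by auto
  then obtain j where "j < n" "a i j \<noteq> 0" using A.neighbour_exists[OF n] by blast
  then show False using *[of i j] i unfolding R_def by blast
qed

text \<open>With \<open>l\<close> a second neighbour of \<open>k\<close> in \<open>D\<close>, hence
  a leaf, both \<open>d\<close> and \<open>l\<close> turn out to be leaves at \<open>k\<close> in
  \<open>b\<close>. The dual of \<open>leaf_b\<close> makes their rows in \<open>a\<close>
  proportional, so \<open>d\<close> is a leaf of \<open>a\<close> as well.\<close>

lemma no_single_nonleaf_neighbour:
  assumes k: "k < n" and d: "d \<in> D" "a k d \<noteq> 0" "\<not> leaf_at d k"
    and leaves: "\<And>j. j < n \<Longrightarrow> a k j \<noteq> 0 \<Longrightarrow> j \<noteq> d \<Longrightarrow> leaf_at j k"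
  shows False
proof -
  have dn: "d < n" using d D_less by simp
  obtain l where l: "l \<in> D" "l \<noteq> d" "a k l \<noteq> 0" using second_D_neighbour[OF d(1) k d(2)] by blast
  have ln: "l < n" and leaf: "leaf_at l k" using l leaves D_less by auto
  have alk: "a l k \<noteq> 0" using l(3) sym_a[OF k ln] by simp
  have split: "(\<Sum>j<n. f j) = f d + (\<Sum>j\<in>{..<n} - {d}. f j)" for f :: "nat \<Rightarrow> real"
    using dn by (simp add: sum.remove)
  have pkk: "p k k = 1"
  proof -
    have "a l k = (\<Sum>j<n. a l j * p j k)" using a_p[OF ln k] by simp
    also have "\<dots> = a l k * p k k" using leaf k unfolding leaf_at_def by (intro sum_eq_single) auto
    finally show ?thesis using alk by simp
  qed
  then have kD: "k \<notin> D" unfolding D_def by simp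
  \<comment> \<open>If this entry vanished, so would \<open>p j d\<close> for every leaf
    \<open>j\<close> at \<open>k\<close>, and row \<open>k\<close> of \<open>a\<close> times
    \<open>p\<close> would force \<open>p d d = 1\<close>.\<close>
  have bkd: "b k d \<noteq> 0"
  proof
    assume b0: "b k d = 0"
    have "a k j * p j d = 0" if "j < n" "j \<noteq> d" for j
      using leaf_p[of j k d] leaves[of j] that k b0 by (cases "a k j = 0") auto
    then have "(\<Sum>j<n. a k j * p j d) = a k d * p d d" by (intro sum_eq_single dn)
    then have "p d d = 1" using a_p[OF k dn] d(2) by simp
    then show False using d(1) unfolding D_def by simp
  qed
  \<comment> \<open>If this entry vanished, then \<open>p l l = 0\<close>, so row \<open>l\<close>
    of \<open>p\<close>, and with it row \<open>l\<close> of \<open>a\<close>, would be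
    zero.\<close>
  have blk: "b l k \<noteq> 0"
  proof
    assume "b l k = 0"
    then have "p l l = 0" using leaf_p[OF ln k leaf] sym_b[OF ln k] by simp
    then have "(\<Sum>j<n. (p l j)\<^sup>2) = 0" using p_sum_squares[OF ln] by simp
    then have "p l j = 0" if "j < n" for j using that by (subst (asm) sum_nonneg_eq_0_iff) auto
    then have "a l k = 0" using p_a[OF ln k] by simp
    then show False using alk by simp
  qed
  define s where "s = (\<Sum>j\<in>{..<n} - {d}. (a k j)\<^sup>2)"
  have "(a k l)\<^sup>2 \<le> s" unfolding s_def using ln l(2) by (intro member_le_sum) auto
  then have s: "s \<noteq> 0" using l(3) by (metis less_le_not_le zero_less_power2)
  have zero: "b d m = 0 \<and> b l m = 0" if m: "m < n" "m \<noteq> k" for m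
  proof -
    define g where "g = (\<Sum>j<n. b k j * b j m)"
    have leaf_g: "b j m = a j k * g" if "j < n" "a k j \<noteq> 0" "j \<noteq> d" for j
      using leaf_b[of j m k] leaves that m k unfolding g_def by simp
    \<comment> \<open>Since \<open>k\<close> is outside \<open>D\<close>, entry
      \<open>(k, m)\<close> of the product vanishes. The leaves contribute \<open>s * g\<close>,
      because their entries in column \<open>m\<close> of \<open>b\<close> are
      \<open>a j k * g\<close>.\<close>
    have "0 = (\<Sum>j<n. a k j * b j m)" using p_outside[of k m] k kD m unfolding p_def by simp
    also have "\<dots> = a k d * b d m + (\<Sum>j\<in>{..<n} - {d}. a k j * b j m)" by (rule split)
    also have "(\<Sum>j\<in>{..<n} - {d}. a k j * b j m) = (\<Sum>j\<in>{..<n} - {d}. (a k j)\<^sup>2 * g)"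
    proof (rule sum.cong)
      fix j assume "j \<in> {..<n} - {d}"
      then show "a k j * b j m = (a k j)\<^sup>2 * g"
        using leaf_g[of j] sym_a[of k j] k by (cases "a k j = 0") (auto simp: power2_eq_square)
    qed simp
    also have "\<dots> = s * g" unfolding s_def by (simp add: sum_distrib_right)
    finally have eq: "a k d * b d m + s * g = 0" by simp
    have bl: "b l m = a l k * g" using leaf_g l ln by simp
    \<comment> \<open>A nonzero value would give \<open>g \<noteq> 0\<close>, hence
      \<open>b l m \<noteq> 0\<close> and the 4-cycle \<open>d\<close>, \<open>m\<close>,
      \<open>l\<close>, \<open>k\<close> in \<open>b\<close>.\<close>
    have "b d m = 0"
    proof (rule ccontr)
      assume bd: "b d m \<noteq> 0"
      then have "g \<noteq> 0" using eq d(2) by auto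
      then have "b l m \<noteq> 0" using bl alk by simp
      then show False
        using B.no_square[of d m l k] bd blk bkd k dn ln m l(2) sym_b by auto
    qed
    then have "g = 0" using eq s by simp
    then show ?thesis using \<open>b d m = 0\<close> bl by simp
  qed
  have dual_leaf: "inverse_trees.leaf_at n b d k" "inverse_trees.leaf_at n b l k"
    using zero unfolding inverse_trees.leaf_at_def[OF dual] by blast+
  have "a d j = 0" if j: "j < n" "j \<noteq> k" for j
  proof -
    define g where "g = (\<Sum>m<n. a k m * a m j)"
    have "a l j = b l k * g" "a d j = b d k * g"
      unfolding g_def using inverse_trees.leaf_b[OF dual] dual_leaf k ln dn j by auto
    moreover have "a l j = 0" using leaf j unfolding leaf_at_def by blast
    ultimately show ?thesis using blk by simp
  qed
  then show False using d(3) unfolding leaf_at_def by blast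
qed

lemma is_star_a: "is_star n (\<lambda>i j. i < n \<and> j < n \<and> a i j \<noteq> 0)"
proof -
  obtain k i d where k: "k < n" "i \<in> D" "a k i \<noteq> 0"
    and leaves: "\<And>j. j < n \<Longrightarrow> a k j \<noteq> 0 \<Longrightarrow> j \<noteq> d \<Longrightarrow> leaf_at j k"
    using extremal_vertex by blast
  have "leaf_at j k" if j: "j < n" "a k j \<noteq> 0" for j
  proof (rule ccontr)
    assume nl: "\<not> leaf_at j k"
    then have "j = d" using leaves j by blast
    moreover have "j \<in> D" using neighbours_in_D[OF k j] .
    ultimately show False using no_single_nonleaf_neighbour[of k d] k leaves j nl by blast
  qed
  then show ?thesis
    by (intro A.is_star_if_neighbours_leaves[OF k(1)]) (auto simp: leaf_at_def)
qed

end

section \<open>Group inverses of symmetric matrices\<close>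

text \<open>Orthogonal projection onto the span of \<open>m\<close> vectors, by a Gram-Schmidt step:
  the residual \<open>r\<close> of \<open>b\<close> is corrected by a multiple of the residual
  \<open>e\<close> of the new vector \<open>c m\<close>.\<close>

lemma orthogonal_residual:
  fixes c :: "nat \<Rightarrow> nat \<Rightarrow> real" and b :: "nat \<Rightarrow> real"
  shows "\<exists>u. \<forall>j<m. (\<Sum>i<n. c j i * (b i - (\<Sum>k<m. u k * c k i))) = 0"
proof (induction m arbitrary: b)
  case 0
  then show ?case by simp
next
  case (Suc m)
  define ip where "ip f g = (\<Sum>i<n. f i * g i)" for f g :: "nat \<Rightarrow> real"
  have ip_diff: "ip f (\<lambda>i. g i - t * h i) = ip f g - t * ip f h" for f g h t
    unfolding ip_def by (simp add: algebra_simps sum_subtractf sum_distrib_left)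
  obtain w where w: "\<forall>j<m. ip (c j) (\<lambda>i. c m i - (\<Sum>k<m. w k * c k i)) = 0"
    using Suc.IH[of "c m"] unfolding ip_def by blast
  obtain u where u: "\<forall>j<m. ip (c j) (\<lambda>i. b i - (\<Sum>k<m. u k * c k i)) = 0"
    using Suc.IH[of b] unfolding ip_def by blast
  define e where "e i = c m i - (\<Sum>k<m. w k * c k i)" for i
  define r where "r i = b i - (\<Sum>k<m. u k * c k i)" for i
  define t where "t = ip e r / ip e e"
  define x where "x i = r i - t * e i" for i
  have ce: "ip (c j) e = 0" and cr: "ip (c j) r = 0" if "j < m" for j
    using u w that unfolding e_def r_def by auto
  have cx: "ip (c j) x = 0" if "j < m" for j
    using ip_diff[of "c j" r t e] ce cr that unfolding x_def by simp
  \<comment> \<open>Covers a new vector dependent on the earlier ones: then \<open>e\<close>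
    vanishes and the division defining \<open>t\<close> yields 0.\<close>
  have "ip e e = 0 \<Longrightarrow> ip e r = 0"
    unfolding ip_def by (subst (asm) sum_nonneg_eq_0_iff) (auto intro: sum.neutral)
  then have ex: "ip e x = 0" using ip_diff[of e r t e] unfolding x_def t_def by auto
  have "ip (c m) x = ip e x + ip (\<lambda>i. \<Sum>k<m. w k * c k i) x"
    unfolding ip_def e_def by (simp add: algebra_simps sum_subtractf sum.distrib)
  also have "ip (\<lambda>i. \<Sum>k<m. w k * c k i) x = (\<Sum>k<m. w k * ip (c k) x)"
    unfolding ip_def by (simp add: sum_distrib_left sum_distrib_right mult.assoc) (rule sum.swap)
  also have "\<dots> = 0" using cx by simp
  finally have cm: "ip (c m) x = 0" using ex by simp
  define v where "v k = (if k = m then t else u k - t * w k)" for k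
  have "x i = b i - (\<Sum>k<Suc m. v k * c k i)" for i
    unfolding x_def r_def e_def v_def
    by (simp add: algebra_simps sum_subtractf sum_distrib_left)
  then have "\<forall>j<Suc m. ip (c j) (\<lambda>i. b i - (\<Sum>k<Suc m. v k * c k i)) = 0"
    using cx cm by (metis (no_types, lifting) ext less_Suc_eq)
  then show ?case unfolding ip_def by blast
qed

lemma least_squares:
  fixes C :: "real mat"
  assumes C: "C \<in> carrier_mat n m" and b: "b \<in> carrier_vec n"
  shows "\<exists>u\<in>carrier_vec m. transpose_mat C *\<^sub>v (b - C *\<^sub>v u) = 0\<^sub>v m"
proof -
  obtain u where u: "\<forall>j<m. (\<Sum>i<n. C $$ (i, j) * (b $ i - (\<Sum>k<m. u k * C $$ (i, k)))) = 0"
    using orthogonal_residual[where c = "\<lambda>j i. C $$ (i, j)" and b = "\<lambda>i. b $ i"] by blast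
  have "transpose_mat C *\<^sub>v (b - C *\<^sub>v vec m u) = 0\<^sub>v m"
  proof (rule eq_vecI)
    fix j assume "j < dim_vec (0\<^sub>v m :: real vec)"
    then have j: "j < m" by simp
    have "(transpose_mat C *\<^sub>v (b - C *\<^sub>v vec m u)) $ j
        = (\<Sum>i<n. C $$ (i, j) * (b $ i - (\<Sum>k<m. u k * C $$ (i, k))))"
      using C b j by (simp add: scalar_prod_def atLeast0LessThan mult.commute)
    then show "(transpose_mat C *\<^sub>v (b - C *\<^sub>v vec m u)) $ j = 0\<^sub>v m $ j"
      using u j by simp
  qed (use C in simp)
  then show ?thesis by (intro bexI[of _ "vec m u"]) auto
qed

lemma scalar_prod_self_zero:
  fixes v :: "real vec"
  assumes v: "v \<in> carrier_vec n" and "v \<bullet> v = 0"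
  shows "v = 0\<^sub>v n"
proof (rule eq_vecI)
  have "(\<Sum>i<n. v $ i * v $ i) = 0"
    using assms by (simp add: scalar_prod_def atLeast0LessThan)
  then have "v $ i = 0" if "i < n" for i
    using that by (subst (asm) sum_nonneg_eq_0_iff) auto
  then show "v $ i = 0\<^sub>v n $ i" if "i < dim_vec (0\<^sub>v n :: real vec)" for i using that by simp
qed (use v in simp)

text \<open>Least squares for \<open>A * A\<close> and the target \<open>A *\<^sub>v b\<close> gives
  a residual \<open>z\<close> killed by \<open>A * A\<close>. By symmetry
  \<open>A *\<^sub>v z\<close> is orthogonal to itself, so it is zero; as \<open>z\<close> is also
  in the range of \<open>A\<close>, the same argument gives \<open>z = 0\<close>.\<close>

lemma symmetric_square_solvable:
  fixes A :: "real mat"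
  assumes A: "A \<in> carrier_mat n n" and sym: "transpose_mat A = A" and b: "b \<in> carrier_vec n"
  shows "\<exists>u\<in>carrier_vec n. A *\<^sub>v (A *\<^sub>v u) = A *\<^sub>v b"
proof -
  have adjoint: "(A *\<^sub>v x) \<bullet> y = x \<bullet> (A *\<^sub>v y)" if "x \<in> carrier_vec n" "y \<in> carrier_vec n" for x y
    using transpose_vec_mult_scalar[OF A that(2,1)] sym by simp
  have AA: "A * A \<in> carrier_mat n n" "transpose_mat (A * A) = A * A"
    using A sym transpose_mult[OF A A] by auto
  have Ab: "A *\<^sub>v b \<in> carrier_vec n" using A b by simp
  obtain u where u: "u \<in> carrier_vec n" and eq: "(A * A) *\<^sub>v (A *\<^sub>v b - (A * A) *\<^sub>v u) = 0\<^sub>v n"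
    using least_squares[OF AA(1) Ab] AA(2) by auto
  define y where "y = b - A *\<^sub>v u"
  define z where "z = A *\<^sub>v y"
  have Au: "A *\<^sub>v u \<in> carrier_vec n" using A u by simp
  have y: "y \<in> carrier_vec n" using b Au unfolding y_def by simp
  have z: "z \<in> carrier_vec n" using A y unfolding z_def by simp
  have Az: "A *\<^sub>v z \<in> carrier_vec n" using A z by simp
  have z_eq: "z = A *\<^sub>v b - A *\<^sub>v (A *\<^sub>v u)"
    unfolding z_def y_def using mult_minus_distrib_mat_vec[OF A b Au] .
  have "A *\<^sub>v (A *\<^sub>v z) = 0\<^sub>v n"
    using eq z unfolding assoc_mult_mat_vec[OF A A u] z_eq[symmetric] assoc_mult_mat_vec[OF A A z] by simp
  then have "(A *\<^sub>v z) \<bullet> (A *\<^sub>v z) = 0" using adjoint[OF z Az] z by simp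
  then have "A *\<^sub>v z = 0\<^sub>v n" using scalar_prod_self_zero Az by blast
  then have "z \<bullet> z = 0" using adjoint[OF z y] y unfolding z_def[symmetric] by simp
  then have "z = 0\<^sub>v n" using scalar_prod_self_zero z by blast
  then have diff: "A *\<^sub>v b - A *\<^sub>v (A *\<^sub>v u) = 0\<^sub>v n" using z_eq by simp
  have "A *\<^sub>v (A *\<^sub>v u) = A *\<^sub>v b"
  proof (rule eq_vecI)
    fix i assume "i < dim_vec (A *\<^sub>v b)"
    then show "(A *\<^sub>v (A *\<^sub>v u)) $ i = (A *\<^sub>v b) $ i"
      using arg_cong[OF diff, of "\<lambda>w. w $ i"] A by (simp del: index_mult_mat_vec)
  qed simp
  then show ?thesis using u by blast
qed

lemma mat_mult_unit_vec_col:
  fixes A :: "'a::semiring_1 mat"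
  assumes "A \<in> carrier_mat m n" "j < n"
  shows "A *\<^sub>v unit_vec n j = col A j"
  using assms by (intro eq_vecI) (auto simp: scalar_prod_right_unit)

lemma symmetric_square_factor:
  fixes A :: "real mat"
  assumes A: "A \<in> carrier_mat n n" and sym: "transpose_mat A = A"
  shows "\<exists>Y\<in>carrier_mat n n. A * (A * Y) = A"
proof -
  have "\<exists>u\<in>carrier_vec n. A *\<^sub>v (A *\<^sub>v u) = col A j" if "j < n" for j
    using symmetric_square_solvable[OF A sym unit_vec_carrier[of n j]] mat_mult_unit_vec_col[OF A that] by simp
  then obtain U where U: "\<And>j. j < n \<Longrightarrow> U j \<in> carrier_vec n \<and> A *\<^sub>v (A *\<^sub>v U j) = col A j" by metis
  define Y where "Y = mat n n (\<lambda>(i, j). U j $ i)"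
  have Y: "Y \<in> carrier_mat n n" unfolding Y_def by simp
  have AY: "A * Y \<in> carrier_mat n n" using A Y by simp
  have colY: "col Y j = U j" if "j < n" for j
    using U[OF that] that unfolding Y_def by (intro eq_vecI) auto
  have "A * (A * Y) = A"
  proof (rule mat_col_eqI)
    fix j assume "j < dim_col A"
    then have j: "j < n" using A by simp
    have "col (A * (A * Y)) j = A *\<^sub>v (A *\<^sub>v col Y j)"
      unfolding col_mult2[OF A AY j] col_mult2[OF A Y j] ..
    then show "col (A * (A * Y)) j = col A j" using colY[OF j] U[OF j] by simp
  qed (use A Y in auto)
  then show ?thesis using Y by blast
qed

text \<open>Uniqueness behind the \<open>THE\<close> in \<open>group_inverse\<close>: two candidates
  \<open>X\<close>, \<open>Y\<close> satisfy \<open>A * X = A * Y\<close>, and then each of them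
  equals \<open>Y * A * X\<close>.\<close>

lemma group_inverse_eqI:
  assumes A: "A \<in> carrier_mat n n" and X: "X \<in> carrier_mat n n"
    and AXA: "A * X * A = A" and XAX: "X * A * X = X" and AX: "A * X = X * A"
  shows "group_inverse A = X"
  unfolding group_inverse_def
proof (rule the_equality)
  show "X \<in> carrier_mat (dim_row A) (dim_row A) \<and> A * X * A = A \<and> X * A * X = X \<and> A * X = X * A"
    using assms by auto
  fix Y assume "Y \<in> carrier_mat (dim_row A) (dim_row A) \<and> A * Y * A = A \<and> Y * A * Y = Y \<and> A * Y = Y * A"
  then have Y: "Y \<in> carrier_mat n n" and AYA: "A * Y * A = A" and YAY: "Y * A * Y = Y" and AY: "A * Y = Y * A"
    using A by auto
  have "A * X = A * Y * A * X" by (simp add: AYA)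
  also have "\<dots> = A * Y * (A * X)" using A X Y by (intro assoc_mult_mat[of _ n n _ n _ n]) auto
  also have "\<dots> = Y * A * (X * A)" by (simp add: AX AY)
  also have "\<dots> = Y * (A * X * A)" using A X Y by (simp add: assoc_mult_mat[of _ n n _ n _ n])
  finally have eq: "A * X = A * Y" by (simp add: AXA AY)
  have "X = Y * A * X" using XAX AX AY eq by simp
  also have "\<dots> = Y * (A * X)" using A X Y by (intro assoc_mult_mat) auto
  also have "\<dots> = Y * A * Y" unfolding eq using A Y by (intro assoc_mult_mat[symmetric]) auto
  finally show "Y = X" using YAY by simp
qed

text \<open>From \<open>A * (A * Y) = A\<close> and its transpose with \<open>Z\<close>, the inverse
  is \<open>Z * A * Y\<close>. Its symmetry follows from uniqueness, as the transpose satisfies the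
  same equations.\<close>

lemma symmetric_group_inverse:
  fixes A :: "real mat"
  assumes A: "A \<in> carrier_mat n n" and sym: "transpose_mat A = A"
  defines "X \<equiv> group_inverse A"
  shows "X \<in> carrier_mat n n" "A * X * A = A" "X * A * X = X" "A * X = X * A" "transpose_mat X = X"
proof -
  obtain Y where Y: "Y \<in> carrier_mat n n" and AAY: "A * (A * Y) = A"
    using symmetric_square_factor[OF A sym] by blast
  define Z where "Z = transpose_mat Y"
  note assoc = assoc_mult_mat[of _ n n _ n _ n]
  have Z: "Z \<in> carrier_mat n n" using Y unfolding Z_def by simp
  have ZAA: "Z * A * A = A"
  proof -
    have "Z * A * A = transpose_mat (A * (A * Y))"
      unfolding Z_def using A Y by (simp add: transpose_mult[of _ n n _ n] sym)
    then show ?thesis using AAY sym by simp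
  qed
  have ZA: "Z * A = A * Y"
  proof -
    \<comment> \<open>The product \<open>Z * A * A * Y\<close> is evaluated in two ways.\<close>
    have "Z * A = Z * (A * (A * Y))" by (simp add: AAY)
    also have "\<dots> = Z * A * A * Y" using A Y Z by (simp add: assoc)
    finally show ?thesis by (simp add: ZAA)
  qed
  define W where "W = Z * A * Y"
  have W: "W \<in> carrier_mat n n" unfolding W_def using A Y Z by simp
  have AW: "A * W = A * Y"
  proof -
    have "A * W = A * (A * Y * Y)" unfolding W_def ZA ..
    also have "\<dots> = A * (A * Y) * Y" using A Y by (simp add: assoc)
    finally show ?thesis by (simp add: AAY)
  qed
  have WA: "W * A = A * Y"
  proof -
    have "A * Y * A = A" using ZAA ZA by simp
    moreover have "W * A = Z * (A * Y * A)" unfolding W_def using A Y Z by (simp add: assoc)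
    ultimately show ?thesis by (simp add: ZA)
  qed
  have AWA: "A * W * A = A"
  proof -
    have "A * W * A = A * (W * A)" using A W by (intro assoc_mult_mat) auto
    then show ?thesis by (simp add: WA AAY)
  qed
  have WAW: "W * A * W = W"
  proof -
    have "W * A * W = Z * A * W" unfolding WA ZA ..
    also have "\<dots> = Z * (A * W)" using A Z W by (intro assoc_mult_mat) auto
    also have "\<dots> = W" unfolding AW unfolding W_def using A Z Y by (simp add: assoc)
    finally show ?thesis .
  qed
  have X: "X = W" unfolding X_def using group_inverse_eqI[OF A W AWA WAW] AW WA by simp
  show inv: "X \<in> carrier_mat n n" "A * X * A = A" "X * A * X = X" "A * X = X * A"
    unfolding X using W AWA WAW AW WA by auto
  have tr: "transpose_mat (B * C) = transpose_mat C * transpose_mat B"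
    if "B \<in> carrier_mat n n" "C \<in> carrier_mat n n" for B C :: "real mat"
    using transpose_mult[OF that] .
  have "A * transpose_mat X * A = transpose_mat (A * X * A)"
    using A inv(1) by (simp add: tr sym assoc)
  then have "A * transpose_mat X * A = A" by (simp only: inv(2) sym)
  moreover have "transpose_mat X * A * transpose_mat X = transpose_mat (X * A * X)"
    using A inv(1) by (simp add: tr sym assoc)
  then have "transpose_mat X * A * transpose_mat X = transpose_mat X" by (simp only: inv(3))
  moreover have "A * transpose_mat X = transpose_mat X * A"
    using A inv(1) tr[of X A] tr[of A X] sym inv(4) by simp
  ultimately show "transpose_mat X = X"
    using group_inverse_eqI[OF A, of "transpose_mat X"] inv(1) unfolding X_def[symmetric] by simp
qed

section \<open>Stars and the equivalence\<close>

lemma mat_graph_square: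
  "A \<in> carrier_mat n n \<Longrightarrow> mat_graph A = (\<lambda>i j. i < n \<and> j < n \<and> A $$ (i, j) \<noteq> 0)"
  unfolding mat_graph_def by auto

lemma mult_mat_entry:
  "A \<in> carrier_mat n n \<Longrightarrow> B \<in> carrier_mat n n \<Longrightarrow> i < n \<Longrightarrow> j < n \<Longrightarrow>
    (A * B) $$ (i, j) = (\<Sum>k<n. A $$ (i, k) * B $$ (k, j))"
  by (simp add: scalar_prod_def atLeast0LessThan)

lemma symmetric_mat_entry:
  assumes "A \<in> carrier_mat n n" "transpose_mat A = A" "i < n" "j < n"
  shows "A $$ (i, j) = A $$ (j, i)"
  using assms by (metis carrier_matD index_transpose_mat(1))

text \<open>The cube of \<open>A\<close> is \<open>s\<close> times \<open>A\<close>, so scaling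
  \<open>A\<close> by \<open>inverse s\<close> satisfies the defining equations and leaves the
  support unchanged.\<close>

lemma star_group_inverse_graph:
  assumes A: "A \<in> carrier_mat n n" and sym: "transpose_mat A = A"
    and star: "is_star n (mat_graph A)"
  shows "mat_graph (group_inverse A) = mat_graph A"
proof -
  obtain c where c: "c < n"
    and adj: "\<And>i j. mat_graph A i j \<longleftrightarrow> i < n \<and> j < n \<and> i \<noteq> j \<and> (i = c \<or> j = c)"
    using star unfolding is_star_def by blast
  have nz: "A $$ (i, j) \<noteq> 0 \<longleftrightarrow> i \<noteq> j \<and> (i = c \<or> j = c)" if "i < n" "j < n" for i j
    using adj[of i j] that mat_graph_square[OF A] by simp
  have zero: "A $$ (i, j) = 0" if "i < n" "j < n" "i = j \<or> i \<noteq> c \<and> j \<noteq> c" for i j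
    using nz[of i j] that by auto
  define s where "s = (\<Sum>k<n. (A $$ (c, k))\<^sup>2)"
  have row: "(A * A) $$ (i, j) = A $$ (i, c) * A $$ (c, j)" if "i < n" "j < n" "i \<noteq> c" for i j
    unfolding mult_mat_entry[OF A A that(1,2)] using c zero that by (intro sum_eq_single) auto
  have centre: "(A * A) $$ (c, j) = (if j = c then s else 0)" if j: "j < n" for j
  proof (cases "j = c")
    case True
    then show ?thesis
      unfolding mult_mat_entry[OF A A c j] s_def
      using symmetric_mat_entry[OF A sym _ c] by (simp add: power2_eq_square)
  next
    case False
    have "A $$ (c, k) * A $$ (k, j) = 0" if "k < n" for k
      using zero[of c k] zero[of k j] that c j False by (cases "k = c") auto
    then have "(\<Sum>k<n. A $$ (c, k) * A $$ (k, j)) = 0" by (intro sum.neutral) auto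
    then show ?thesis unfolding mult_mat_entry[OF A A c j] using False by simp
  qed
  have AA: "A * A \<in> carrier_mat n n" using A by simp
  have AAA: "A * A * A = s \<cdot>\<^sub>m A"
  proof (rule eq_matI)
    fix i j assume "i < dim_row (s \<cdot>\<^sub>m A)" "j < dim_col (s \<cdot>\<^sub>m A)"
    then have ij: "i < n" "j < n" using A by auto
    have "(A * A * A) $$ (i, j) = (\<Sum>k<n. (A * A) $$ (i, k) * A $$ (k, j))"
      by (rule mult_mat_entry[OF AA A ij])
    also have "\<dots> = s * A $$ (i, j)"
    proof (cases "i = c")
      case True
      have "(\<Sum>k<n. (A * A) $$ (i, k) * A $$ (k, j)) = (A * A) $$ (i, c) * A $$ (c, j)"
        using True c centre by (intro sum_eq_single) auto
      then show ?thesis using True centre[OF c] by simp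
    next
      case False
      have "(\<Sum>k<n. (A * A) $$ (i, k) * A $$ (k, j)) = A $$ (i, c) * (\<Sum>k<n. A $$ (c, k) * A $$ (k, j))"
        using row[OF ij(1) _ False] by (simp add: sum_distrib_left mult.assoc)
      also have "\<dots> = A $$ (i, c) * (if j = c then s else 0)"
        using centre[OF ij(2)] mult_mat_entry[OF A A c ij(2)] by simp
      finally show ?thesis using zero[OF ij] False by auto
    qed
    finally show "(A * A * A) $$ (i, j) = (s \<cdot>\<^sub>m A) $$ (i, j)" using A ij by simp
  qed (use A in auto)
  have degenerate: "s \<cdot>\<^sub>m A = 0\<^sub>m n n \<and> A = 0\<^sub>m n n" if "s = 0"
  proof -
    have c0: "A $$ (c, k) = 0" if "k < n" for k
      using \<open>s = 0\<close> that unfolding s_def by (subst (asm) sum_nonneg_eq_0_iff) auto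
    have "A $$ (i, j) = 0" if "i < n" "j < n" for i j
      using zero[OF that] symmetric_mat_entry[OF A sym that] c0[of i] c0[of j] that
      by (cases "i = c"; cases "j = c") simp_all
    then have "A = 0\<^sub>m n n" using A by (intro eq_matI) auto
    then show ?thesis by simp
  qed
  \<comment> \<open>For the star with one vertex, \<open>s\<close> and \<open>A\<close> are zero;
    then \<open>inverse s = 0\<close> and \<open>X\<close> is the zero matrix, which is still the
    group inverse.\<close>
  define X where "X = inverse s \<cdot>\<^sub>m A"
  have X: "X \<in> carrier_mat n n" using A unfolding X_def by simp
  have AX: "A * X = inverse s \<cdot>\<^sub>m (A * A)" and XA: "X * A = inverse s \<cdot>\<^sub>m (A * A)"
    unfolding X_def using A by (auto simp: mult_smult_distrib[OF A A] mult_smult_assoc_mat[OF A A])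
  have AXA: "A * X * A = A"
  proof (cases "s = 0")
    case True
    then show ?thesis using degenerate X by simp
  next
    case False
    have "A * X * A = inverse s \<cdot>\<^sub>m (s \<cdot>\<^sub>m A)"
      unfolding AX mult_smult_assoc_mat[OF AA A] AAA ..
    also have "\<dots> = A" using False by (intro eq_matI) auto
    finally show ?thesis .
  qed
  have XAX: "X * A * X = X"
  proof -
    have "X * A * X = A * X * X" using AX XA by simp
    also have "\<dots> = A * X * (inverse s \<cdot>\<^sub>m A)" by (simp only: X_def)
    also have "\<dots> = inverse s \<cdot>\<^sub>m (A * X * A)" using A X by (intro mult_smult_distrib) auto
    finally show ?thesis by (simp only: AXA X_def[symmetric])
  qed
  have "group_inverse A = X" using group_inverse_eqI[OF A X AXA XAX] AX XA by simp
  moreover have "X $$ (i, j) \<noteq> 0 \<longleftrightarrow> A $$ (i, j) \<noteq> 0" if "i < n" "j < n" for i j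
    using that A degenerate unfolding X_def by auto
  ultimately show ?thesis using mat_graph_square[OF A] mat_graph_square[OF X] by (auto simp: fun_eq_iff)
qed

text \<open>Walks and cycles are transported along \<open>f\<close>. As \<open>graph_iso\<close>
  constrains only indices below \<open>n\<close>, \<open>bounded\<close> excludes edges
  elsewhere.\<close>

lemma graph_iso_is_tree:
  assumes iso: "graph_iso n adj1 adj2" and tree: "is_tree n adj2"
    and bounded: "\<And>i j. adj1 i j \<Longrightarrow> i < n \<and> j < n"
  shows "is_tree n adj1"
proof -
  interpret T: tree n adj2 using tree by unfold_locales
  obtain f where f: "bij_betw f {..<n} {..<n}"
    and adj: "\<And>i j. i < n \<Longrightarrow> j < n \<Longrightarrow> adj1 i j \<longleftrightarrow> adj2 (f i) (f j)"
    using iso unfolding graph_iso_def by blast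
  have fn: "f i < n" if "i < n" for i using f that unfolding bij_betw_def by auto
  have inj: "inj_on f {..<n}" using f unfolding bij_betw_def by simp
  have "simple_graph n adj1"
    using adj bounded T.adj_sym T.adj_irrefl unfolding simple_graph_def by metis
  moreover have "graph_connected n adj1" unfolding graph_connected_def
  proof (intro allI impI)
    fix i j assume i: "i < n" and j: "j < n"
    \<comment> \<open>The induction follows the walk in \<open>adj2\<close> and speaks of preimages
      under \<open>f\<close>.\<close>
    have "\<forall>m<n. f m = v \<longrightarrow> adj1\<^sup>*\<^sup>* i m" if "adj2\<^sup>*\<^sup>* (f i) v" for v
      using that
    proof (induction rule: rtranclp_induct)
      case base
      then show ?case using inj i by (auto simp: inj_on_eq_iff)
    next
      case (step y z)
      have "y < n" using step(2) T.adj_less by blast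
      then have "y \<in> f ` {..<n}" using f unfolding bij_betw_def by simp
      then obtain l where l: "l < n" "f l = y" by auto
      show ?case
      proof (intro allI impI)
        fix m assume m: "m < n" "f m = z"
        have "adj1 l m" using adj l m step(2) by simp
        moreover have "adj1\<^sup>*\<^sup>* i l" using step.IH l by blast
        ultimately show "adj1\<^sup>*\<^sup>* i m" by (rule rtranclp.rtrancl_into_rtrancl[rotated])
      qed
    qed
    then show "adj1\<^sup>*\<^sup>* i j" using T.reachable[OF fn[OF i] fn[OF j]] j by blast
  qed
  moreover have "graph_acyclic n adj1" unfolding graph_acyclic_def
  proof
    assume "\<exists>vs. 3 \<le> length vs \<and> graph_path n adj1 vs \<and> adj1 (last vs) (hd vs)"
    then obtain vs where vs: "3 \<le> length vs" "graph_path n adj1 vs" "adj1 (last vs) (hd vs)" by blast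
    have ne: "vs \<noteq> []" using vs(1) by auto
    have "graph_path n adj2 (map f vs)" unfolding graph_path_def
    proof (intro conjI allI impI)
      have sub: "set vs \<subseteq> {..<n}" using vs(2) unfolding graph_path_def by simp
      show "distinct (map f vs)" using vs(2) inj_on_subset[OF inj sub]
        unfolding graph_path_def by (simp add: distinct_map)
      show "set (map f vs) \<subseteq> {..<n}" using sub fn by auto
      show "2 \<le> length (map f vs)" using vs(1) by simp
      fix i assume i: "i < length (map f vs) - 1"
      then have "adj1 (vs ! i) (vs ! Suc i)" using vs(2) unfolding graph_path_def by simp
      then show "adj2 (map f vs ! i) (map f vs ! Suc i)" 
        using i adj[of "vs ! i" "vs ! Suc i"] bounded[of "vs ! i" "vs ! Suc i"] by simp
    qed
    moreover have "adj2 (last (map f vs)) (hd (map f vs))"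
      using vs(3) adj[of "last vs" "hd vs"] bounded[OF vs(3)] ne by (simp add: last_map hd_map)
    ultimately show False using T.acyclic vs(1) unfolding graph_acyclic_def
      by (metis length_map)
  qed
  ultimately show ?thesis using tree unfolding is_tree_def by simp
qed

lemma is_star_single_vertex: "is_tree 1 adj \<Longrightarrow> is_star 1 adj"
  unfolding is_tree_def simple_graph_def is_star_def by (intro exI[of _ 0]) auto

text \<open>A single vertex is treated apart, since \<open>inverse_trees\<close> asks for two
  vertices. The locale's \<open>not_inverse\<close> holds because \<open>A * X = 1\<^sub>m n\<close>
  would contradict \<open>det A = 0\<close>.\<close>

lemma is_star_if_group_inverse_tree:
  assumes A: "A \<in> carrier_mat n n" and sym: "transpose_mat A = A"
    and tree: "is_tree n (mat_graph A)" and det: "det A = 0"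
    and tree': "is_tree n (mat_graph (group_inverse A))"
  shows "is_star n (mat_graph A)"
proof (cases "n = 1")
  case True
  then show ?thesis using tree is_star_single_vertex by simp
next
  case False
  then have n: "2 \<le> n" using tree unfolding is_tree_def by simp
  define X where "X = group_inverse A"
  note X = symmetric_group_inverse[OF A sym, folded X_def]
  have AX: "A * X \<in> carrier_mat n n" and XA: "X * A \<in> carrier_mat n n" using A X(1) by auto
  have entry_AX: "(\<Sum>k<n. A $$ (i, k) * X $$ (k, j)) = (A * X) $$ (i, j)" if "i < n" "j < n" for i j
    using mult_mat_entry[OF A X(1) that] by simp
  have entry_XA: "(\<Sum>k<n. X $$ (i, k) * A $$ (k, j)) = (X * A) $$ (i, j)" if "i < n" "j < n" for i j
    using mult_mat_entry[OF X(1) A that] by simp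
  have "inverse_trees n (\<lambda>i j. A $$ (i, j)) (\<lambda>i j. X $$ (i, j))"
  proof
    show "is_tree n (\<lambda>i j. i < n \<and> j < n \<and> A $$ (i, j) \<noteq> 0)"
      using tree mat_graph_square[OF A] by simp
    show "is_tree n (\<lambda>i j. i < n \<and> j < n \<and> X $$ (i, j) \<noteq> 0)"
      using tree' mat_graph_square[OF X(1)] unfolding X_def by simp
    fix i j assume ij: "i < n" "j < n"
    show "A $$ (i, j) = A $$ (j, i)" "X $$ (i, j) = X $$ (j, i)"
      using symmetric_mat_entry ij A sym X by blast+
    show "(\<Sum>k<n. A $$ (i, k) * X $$ (k, j)) = (\<Sum>k<n. X $$ (i, k) * A $$ (k, j))"
      using entry_AX[OF ij] entry_XA[OF ij] X(4) by simp
    show "(\<Sum>l<n. (\<Sum>k<n. A $$ (i, k) * X $$ (k, l)) * A $$ (l, j)) = A $$ (i, j)"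
      using mult_mat_entry[OF AX A ij] X(2) ij by (simp add: entry_AX del: index_mult_mat)
    show "(\<Sum>l<n. (\<Sum>k<n. X $$ (i, k) * A $$ (k, l)) * X $$ (l, j)) = X $$ (i, j)"
      using mult_mat_entry[OF XA X(1) ij] X(3) ij by (simp add: entry_XA del: index_mult_mat)
  next
    show "\<exists>i<n. \<exists>j<n. (\<Sum>k<n. A $$ (i, k) * X $$ (k, j)) \<noteq> (if i = j then 1 else 0)"
    proof (rule ccontr)
      assume "\<not> ?thesis"
      then have "A * X = 1\<^sub>m n"
        using A X(1) by (intro eq_matI) (auto simp: entry_AX[symmetric] simp del: index_mult_mat(1))
      then have "det A * det X = 1" using det_mult[OF A X(1)] by simp
      then show False using det by simp
    qed
  qed (rule n)
  from inverse_trees.is_star_a[OF this] show ?thesis using mat_graph_square[OF A] by simp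
qed

text \<open>A nonzero kernel vector excludes a perfect matching, so a maximum matching misses some
  vertex \<open>d\<close>, and the combinatorial argument applies.\<close>

lemma is_star_if_few_alternating_paths:
  assumes A: "A \<in> carrier_mat n n" and tree: "is_tree n (mat_graph A)" and det: "det A = 0"
    and card: "card (alternating_paths n (mat_graph A)) = n - 1"
  shows "is_star n (mat_graph A)"
proof (cases "n = 1")
  case True
  then show ?thesis using tree is_star_single_vertex by simp
next
  case False
  then have n: "2 \<le> n" using tree unfolding is_tree_def by simp
  interpret T: tree n "mat_graph A" using tree by unfold_locales
  obtain M where M: "is_max_matching (mat_graph A) M" using T.max_matching_exists by blast
  obtain v where v: "v \<in> carrier_vec n" "v \<noteq> 0\<^sub>v n" "A *\<^sub>v v = 0\<^sub>v n"
    using det det_0_iff_vec_prod_zero_field[OF A] by blast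
  have "\<exists>d<n. d \<notin> \<Union>M"
  proof (rule ccontr)
    assume "\<not> ?thesis"
    then have perfect: "i \<in> \<Union>M" if "i < n" for i using that by blast
    have "v $ i = 0" if i: "i < n" for i
    proof (rule T.kernel_zero_if_perfect_matching[where a = "\<lambda>i j. A $$ (i, j)"])
      show "is_matching (mat_graph A) M" using M by (rule T.max_matching_matching)
      show "A $$ (i, j) \<noteq> 0 \<longleftrightarrow> mat_graph A i j" if "i < n" "j < n" for i j
        using that mat_graph_square[OF A] by simp
      show "(\<Sum>j<n. A $$ (i, j) * v $ j) = 0" if "i < n" for i
        using arg_cong[OF v(3), of "\<lambda>w. w $ i"] that A v(1)
        by (simp add: scalar_prod_def atLeast0LessThan)
    qed (use perfect i in auto)
    then have "v = 0\<^sub>v n" using v(1) by (intro eq_vecI) auto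
    then show False using v(2) by simp
  qed
  then show ?thesis using T.is_star_if_card_alternating_paths[OF M _ _ n card] by blast
qed

theorem theorem2p12:
  fixes A :: "real mat" and n :: nat
  assumes "A \<in> carrier_mat n n"
    and "transpose_mat A = A"
    and "is_tree n (mat_graph A)"
    and "det A = 0"
  shows "(card (alternating_paths n (mat_graph A)) = n - 1 \<longleftrightarrow> is_tree n (mat_graph (group_inverse A)))
       \<and> (is_tree n (mat_graph (group_inverse A)) \<longleftrightarrow> is_star n (mat_graph A))
       \<and> (is_star n (mat_graph A) \<longleftrightarrow> graph_iso n (mat_graph (group_inverse A)) (mat_graph A))"
proof -
  interpret T: tree n "mat_graph A" using assms(3) by unfold_locales
  have inv: "group_inverse A \<in> carrier_mat n n" using symmetric_group_inverse[OF assms(1,2)] by simp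
  \<comment> \<open>All equivalences pass through the star: the count and the tree condition each
    imply it, an isomorphism gives the tree condition, and the star gives back all three.\<close>
  have "is_star n (mat_graph A)" if "card (alternating_paths n (mat_graph A)) = n - 1"
    using is_star_if_few_alternating_paths assms that by blast
  moreover have "is_star n (mat_graph A)" if "is_tree n (mat_graph (group_inverse A))"
    using is_star_if_group_inverse_tree assms that by blast
  moreover have "is_tree n (mat_graph (group_inverse A))"
    if "graph_iso n (mat_graph (group_inverse A)) (mat_graph A)"
    using graph_iso_is_tree[OF that assms(3)] mat_graph_square[OF inv] by simp
  moreover have "card (alternating_paths n (mat_graph A)) = n - 1 \<and> is_tree n (mat_graph (group_inverse A))
      \<and> graph_iso n (mat_graph (group_inverse A)) (mat_graph A)" if star: "is_star n (mat_graph A)"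
  proof -
    have "graph_iso n (mat_graph A) (mat_graph A)"
      unfolding graph_iso_def by (intro exI[of _ id]) auto
    then show ?thesis
      using star_group_inverse_graph[OF assms(1,2) star] assms(3) T.card_alternating_paths_star[OF star]
      by simp
  qed
  ultimately show ?thesis by blast
qed

end
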